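(* Let $r>0$, $\theta\in\mathbb{R}$, $\sigma>0$, let $Z\sim\mathrm{VG}(r,\theta,\sigma,0)$, let $h:\mathbb{R}\to\mathbb{R}$ be bounded (and measurable), put $\tilde h(x)=h(x)-\mathbb{E}h(Z)$, and let $f$ be the solution, given in the context, of the variance-gamma Stein equation $$\sigma^2xf''(x)+(\sigma^2r+2\theta x)f'(x)+(r\theta-x)f(x)=\tilde h(x).$$ Then $$\|f\|\le\frac{\|\tilde h\|}{\sqrt{\theta^2+\sigma^2}}\Big(\frac2r+C(r,\theta,\sigma)\Big),\qquad \|f'\|\le\frac{\|\tilde h\|}{\sigma^2}\Big(\frac2r+C(r,\theta,\sigma)\Big),$$ where $$C(r,\theta,\sigma)=\begin{cases}\dfrac{\sqrt\pi\,\Gamma(\frac r2)}{\Gamma(\frac{r+1}2)}\Big(1+\dfrac{\theta^2}{\sigma^2}\Big)^{r/2},& r\ge2,\\[2ex] 6\,\Gamma\big(\tfrac r2\big)\Big(1-\dfrac{1}{(1+\sigma^2/\theta^2)^{1/2}}\Big)^{-r/2},& 0<r<2,\end{cases}$$ and for $\theta=0$ the quantity $1/(1+\sigma^2/\theta^2)^{1/2}$ is read as $0$.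
   Context: $\|\cdot\|$ denotes the supremum norm on $\mathbb{R}$ (values at $x=0$ being understood by continuity, where needed). $\mathrm{VG}(r,\theta,\sigma,0)$ is the distribution on $\mathbb{R}$ with density $$p(x)=\frac{1}{\sigma\sqrt\pi\,\Gamma(\frac r2)}e^{\theta x/\sigma^2}\Big(\frac{|x|}{2\sqrt{\theta^2+\sigma^2}}\Big)^{\frac{r-1}2}K_{\frac{r-1}2}\Big(\frac{\sqrt{\theta^2+\sigma^2}}{\sigma^2}|x|\Big),$$ where $K_\nu$ is the modified Bessel function of the second kind and $I_\nu$ below is the modified Bessel function of the first kind. With $\nu=\frac{r-1}2$ and $\alpha=\sqrt{\theta^2+\sigma^2}/\sigma^2$, the solution $f$ is $$f(x)=-\frac{e^{-\theta x/\sigma^2}}{\sigma^2|x|^\nu}K_\nu(\alpha|x|)\int_0^xe^{\theta t/\sigma^2}|t|^\nu I_\nu(\alpha|t|)\tilde h(t)\,dt-\frac{e^{-\theta x/\sigma^2}}{\sigma^2|x|^\nu}I_\nu(\alpha|x|)\int_x^\infty e^{\theta t/\sigma^2}|t|^\nu K_\nu(\alpha|t|)\tilde h(t)\,dt.$$ It is the unique solution such that $f$ and $f'$ are bounded. *)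

theory Defs
  imports "HOL-Probability.Probability"
begin

(* The Bessel functions below are used at x > 0 and nu > -1/2 only. *)

definition bessel_I :: "real \<Rightarrow> real \<Rightarrow> real" where
  "bessel_I \<nu> x =
     (\<Sum>k. (x / 2) powr (\<nu> + 2 * real k) / (fact k * Gamma (\<nu> + real k + 1)))"

(* Standard integral representation, taken as the definition of K for x > 0. *)
definition bessel_K :: "real \<Rightarrow> real \<Rightarrow> real" where
  "bessel_K \<nu> x = (LBINT t=0..\<infinity>. exp (- x * cosh t) * cosh (\<nu> * t))"

(* The value at x = 0 is irrelevant: a density matters only up to null sets. *)
definition vg_density :: "real \<Rightarrow> real \<Rightarrow> real \<Rightarrow> real \<Rightarrow> real" where
  "vg_density r \<theta> \<sigma> x =
     1 / (\<sigma> * sqrt pi * Gamma (r / 2)) * exp (\<theta> * x / \<sigma>\<^sup>2)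
       * (\<bar>x\<bar> / (2 * sqrt (\<theta>\<^sup>2 + \<sigma>\<^sup>2))) powr ((r - 1) / 2)
       * bessel_K ((r - 1) / 2) (sqrt (\<theta>\<^sup>2 + \<sigma>\<^sup>2) / \<sigma>\<^sup>2 * \<bar>x\<bar>)"

(* Explicit solution, for x \<noteq> 0, of
     \<sigma>^2 x f''(x) + (\<sigma>^2 r + 2 \<theta> x) f'(x) + (r \<theta> - x) f(x) = g(x).
   The first integral is oriented, so it changes sign for x < 0. *)
definition vg_stein_formula ::
    "real \<Rightarrow> real \<Rightarrow> real \<Rightarrow> (real \<Rightarrow> real) \<Rightarrow> real \<Rightarrow> real" where
  "vg_stein_formula r \<theta> \<sigma> g x =
     (let \<nu> = (r - 1) / 2; \<alpha> = sqrt (\<theta>\<^sup>2 + \<sigma>\<^sup>2) / \<sigma>\<^sup>2 in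
      - (exp (- \<theta> * x / \<sigma>\<^sup>2) / (\<sigma>\<^sup>2 * \<bar>x\<bar> powr \<nu>)) * bessel_K \<nu> (\<alpha> * \<bar>x\<bar>)
          * (LBINT t=0..x. exp (\<theta> * t / \<sigma>\<^sup>2) * \<bar>t\<bar> powr \<nu> * bessel_I \<nu> (\<alpha> * \<bar>t\<bar>) * g t)
      - exp (- \<theta> * x / \<sigma>\<^sup>2) / (\<sigma>\<^sup>2 * \<bar>x\<bar> powr \<nu>) * bessel_I \<nu> (\<alpha> * \<bar>x\<bar>)
          * (LBINT t=x..\<infinity>. exp (\<theta> * t / \<sigma>\<^sup>2) * \<bar>t\<bar> powr \<nu> * bessel_K \<nu> (\<alpha> * \<bar>t\<bar>) * g t))"

(* The formula is singular at 0, where the solution is extended by continuity. *)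
definition vg_stein_solution ::
    "real \<Rightarrow> real \<Rightarrow> real \<Rightarrow> (real \<Rightarrow> real) \<Rightarrow> real \<Rightarrow> real" where
  "vg_stein_solution r \<theta> \<sigma> g x =
     (if x = 0 then Lim (at 0) (vg_stein_formula r \<theta> \<sigma> g) else vg_stein_formula r \<theta> \<sigma> g x)"

(* A real supremum: meaningful only if f is bounded on S and S is nonempty. *)
definition sup_norm_on :: "real set \<Rightarrow> (real \<Rightarrow> real) \<Rightarrow> real" where
  "sup_norm_on S f = (SUP x\<in>S. \<bar>f x\<bar>)"

abbreviation sup_norm :: "(real \<Rightarrow> real) \<Rightarrow> real" where
  "sup_norm \<equiv> sup_norm_on UNIV"

definition vg_const :: "real \<Rightarrow> real \<Rightarrow> real \<Rightarrow> real" where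
  "vg_const r \<theta> \<sigma> =
     (if r \<ge> 2 then
        sqrt pi * Gamma (r / 2) / Gamma ((r + 1) / 2) * (1 + \<theta>\<^sup>2 / \<sigma>\<^sup>2) powr (r / 2)
      else
        6 * Gamma (r / 2)
          * (1 - (if \<theta> = 0 then 0 else 1 / (1 + \<sigma>\<^sup>2 / \<theta>\<^sup>2) powr (1 / 2))) powr (- r / 2))"

end

(* With nu = (r-1)/2, alpha = sqrt(theta^2+sigma^2)/sigma^2, beta = theta/sigma^2 and x > 0,
   f(x) = -(U P + V R)/sigma^2, where U and V are e^{-beta x} x^{-nu} times K_nu(alpha x) and
   I_nu(alpha x).  The case x < 0 follows by reflection, since htilde has mean zero.

   The K-part contributes the 2/r: the worst beta is -alpha, where
   int_0^x e^{-t} t^nu I_nu(t) dt = e^{-x} x^{nu+1} (I_nu(x) + I_{nu+1}(x)) / (2 nu + 1),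
   and the products of Bessel functions are controlled by the Wronskian
   x (I_nu K_{nu+1} + I_{nu+1} K_nu) = 1 together with I_{nu+1} <= I_nu and K_nu <= K_{nu+1}.

   The I-part contributes C: the function y |-> y^{-nu} I_nu(y) (y+s)^nu K_nu(y+s) is decreasing,
   so the I-part is at most its value at 0, a multiple of the total mass of
   e^{beta t} |t|^nu K_nu(alpha |t|).  That mass is known because the VG density integrates to 1. *)

theory Submission
  imports Defs
begin

section \<open>The Bessel function K\<close>

text \<open>The estimates produce the expression of the branch r >= 2 of C for every r > 0; the
  branch 0 < r < 2 merely dominates it (\<open>vg_const_base_le\<close>). The monotonicity behind C
  amounts to I_{nu+1}(y) / I_nu(y) <= K_{nu-1}(y+s) / K_nu(y+s). For nu <= 1/2 the left quotient is
  at most 1 and the right one at least 1. For nu > 1/2 neither exceeds 1, and quadratic inequalities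
  coming from the Riccati equations of the quotients separate them. The delicate point for f' is the
  sign of beta: when beta < 0 on a half-line, differentiating the I-part costs a factor 2. Exactly
  then that half-line carries at most half of the total mass, so C is not doubled. The condition r >
  0 enters as nu > -1/2, that is, 2 nu + 1 > 0 and |nu| < nu + 1.\<close>

lemma cosh_ge_quadratic: "1 + t\<^sup>2 / 4 \<le> cosh (t::real)"
proof -
  have "1 + \<bar>t\<bar> + \<bar>t\<bar>\<^sup>2 / 2 \<le> exp \<bar>t\<bar>" by (rule exp_lower_Taylor_quadratic) simp
  moreover have "1 - \<bar>t\<bar> \<le> exp (- \<bar>t\<bar>)" using exp_ge_add_one_self[of "- \<bar>t\<bar>"] by simp
  moreover have "cosh t = (exp \<bar>t\<bar> + exp (- \<bar>t\<bar>)) / 2"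
    by (auto simp: cosh_def abs_if field_simps)
  ultimately show ?thesis by simp
qed

text \<open>The quadratic growth of cosh absorbs any linear exponent, by the inequality of
  arithmetic and geometric means. The spare factor exp(-|t|) is an integrable majorant and also
  kills the boundary terms in \<open>bessel_K_recurrence\<close>.\<close>

lemma exp_cosh_bound:
  fixes x \<nu> t :: real
  assumes "x > 0"
  shows "exp (- x * cosh t) * exp (\<nu> * t) \<le> exp ((\<bar>\<nu>\<bar> + 1)\<^sup>2 / x) * exp (- \<bar>t\<bar>)"
proof -
  define m where "m = \<bar>\<nu>\<bar> + 1"
  have "\<nu> * t + \<bar>t\<bar> \<le> m * \<bar>t\<bar>"
    using abs_ge_self[of "\<nu> * t"] by (simp add: m_def abs_mult algebra_simps)
  also have "m * \<bar>t\<bar> \<le> m\<^sup>2 / x + x * t\<^sup>2 / 4"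
  proof -
    have "0 \<le> (2 * m - x * \<bar>t\<bar>)\<^sup>2 / (4 * x)" using assms by simp
    also have "\<dots> = m\<^sup>2 / x + x * t\<^sup>2 / 4 - m * \<bar>t\<bar>"
      using assms by (simp add: field_simps power2_eq_square abs_if)
    finally show ?thesis by simp
  qed
  also have "x * t\<^sup>2 / 4 \<le> x * cosh t"
  proof -
    have "t\<^sup>2 / 4 \<le> cosh t" using cosh_ge_quadratic[of t] by linarith
    then show ?thesis using mult_left_mono[of "t\<^sup>2 / 4" "cosh t" x] assms by simp
  qed
  finally have "- x * cosh t + \<nu> * t \<le> m\<^sup>2 / x - \<bar>t\<bar>" by simp
  then show ?thesis by (simp add: m_def flip: exp_add)
qed

lemma exp_neg_abs_le: "exp (- \<bar>t::real\<bar>) \<le> 2 * inverse (1 + t\<^sup>2)"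
proof -
  have "1 + \<bar>t\<bar> + \<bar>t\<bar>\<^sup>2 / 2 \<le> exp \<bar>t\<bar>" by (rule exp_lower_Taylor_quadratic) simp
  then have "(1 + t\<^sup>2) / 2 \<le> exp \<bar>t\<bar>" by simp
  moreover have "0 < 1 + t\<^sup>2" by (simp add: add_pos_nonneg)
  ultimately show ?thesis by (simp add: exp_minus field_simps)
qed

lemma integrable_exp_neg_abs: "integrable lborel (\<lambda>t::real. exp (- \<bar>t\<bar>))"
proof (rule Bochner_Integration.integrable_bound)
  show "integrable lborel (\<lambda>t::real. 2 * inverse (1 + t\<^sup>2))"
    using integrable_inverse_1_plus_square by (simp add: set_integrable_def einterval_def)
  show "AE t::real in lborel. norm (exp (- \<bar>t\<bar>)) \<le> norm (2 * inverse (1 + t\<^sup>2))"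
    by (rule AE_I2) (use exp_neg_abs_le in auto)
qed simp

lemma integrable_exp_cosh:
  fixes x \<nu> :: real
  assumes "x > 0"
  shows "integrable lborel (\<lambda>t. exp (- x * cosh t) * exp (\<nu> * t))"
proof (rule Bochner_Integration.integrable_bound)
  show "integrable lborel (\<lambda>t::real. exp ((\<bar>\<nu>\<bar> + 1)\<^sup>2 / x) * exp (- \<bar>t\<bar>))"
    by (simp add: integrable_exp_neg_abs)
  show "AE t in lborel. norm (exp (- x * cosh t) * exp (\<nu> * t))
      \<le> norm (exp ((\<bar>\<nu>\<bar> + 1)\<^sup>2 / x) * exp (- \<bar>t\<bar>))"
    by (rule AE_I2) (use exp_cosh_bound[OF assms] in auto)
  have "continuous_on UNIV (\<lambda>t. exp (- x * cosh t) * exp (\<nu> * t))"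
    by (intro continuous_intros)
  then show "(\<lambda>t. exp (- x * cosh t) * exp (\<nu> * t)) \<in> borel_measurable lborel"
    using borel_measurable_continuous_onI by simp
qed

text \<open>With one exponential on the whole line in place of cosh on a half-line, multiplying the
  integrand by exp(t) or exp(-t) only shifts the order. The derivative and the recurrence of K then
  reduce to pointwise identities.\<close>

lemma bessel_K_whole_line:
  assumes "x > 0"
  shows "bessel_K \<nu> x = (\<integral>t. exp (- x * cosh t) * exp (\<nu> * t) \<partial>lborel) / 2"
proof -
  let ?f = "\<lambda>t. exp (- x * cosh t) * cosh (\<nu> * t)"
  let ?e = "\<lambda>\<nu> t. exp (- x * cosh t) * exp (\<nu> * t)"
  have f: "?f = (\<lambda>t. (?e \<nu> t + ?e (-\<nu>) t) / 2)"
    by (auto simp: cosh_def field_simps)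
  have int: "integrable lborel ?f"
    unfolding f by (intro Bochner_Integration.integrable_add integrable_divide integrable_exp_cosh assms)
  have "(\<integral>t. ?e (-\<nu>) t \<partial>lborel) = (\<integral>t. ?e \<nu> t \<partial>lborel)"
    by (subst lborel_integral_real_affine[of "-1" _ 0]) simp_all
  then have whole: "(\<integral>t. ?f t \<partial>lborel) = (\<integral>t. ?e \<nu> t \<partial>lborel)"
    unfolding f using integrable_exp_cosh[OF assms, of \<nu>] integrable_exp_cosh[OF assms, of "-\<nu>"] by simp
  have "(LBINT t=-\<infinity>..0. ?f t) + (LBINT t=0..\<infinity>. ?f t) = (LBINT t=-\<infinity>..\<infinity>. ?f t)"
    using int by (intro interval_integral_sum)
      (simp add: interval_lebesgue_integrable_def set_integrable_def einterval_def)
  moreover have "(LBINT t=-\<infinity>..0. ?f t) = (LBINT t=0..\<infinity>. ?f t)"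
    by (subst interval_integral_reflect) simp
  moreover have "(LBINT t=-\<infinity>..\<infinity>. ?f t) = (\<integral>t. ?f t \<partial>lborel)"
    by (simp add: interval_lebesgue_integral_def set_lebesgue_integral_def einterval_def)
  ultimately show ?thesis
    unfolding bessel_K_def using whole by simp
qed

lemma bessel_K_nonneg: "x > 0 \<Longrightarrow> 0 \<le> bessel_K \<nu> x"
  by (simp add: bessel_K_whole_line)

lemma integrable_exp_cosh_cosh:
  fixes x \<nu> :: real
  assumes "x > 0"
  shows "integrable lborel (\<lambda>t. exp (- x * cosh t) * cosh (\<nu> * t))"
proof -
  have f: "(\<lambda>t. exp (- x * cosh t) * cosh (\<nu> * t)) = (\<lambda>t. (exp (- x * cosh t) * exp (\<nu> * t)
      + exp (- x * cosh t) * exp (- \<nu> * t)) / 2)"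
    by (auto simp: cosh_def field_simps)
  show ?thesis
    unfolding f by (intro Bochner_Integration.integrable_add integrable_divide integrable_exp_cosh assms)
qed

text \<open>Absolute values, because K is even in its order. This covers both K_nu <= K_{nu+1} for
  nu > -1/2 and K_nu <= K_{nu-1} for nu <= 1/2.\<close>

lemma bessel_K_mono_order:
  assumes "x > 0" "\<bar>\<nu>\<bar> \<le> \<bar>\<mu>\<bar>"
  shows "bessel_K \<nu> x \<le> bessel_K \<mu> x"
proof -
  have c: "cosh (\<nu> * t) \<le> cosh (\<mu> * t)" for t :: real
  proof -
    have "cosh (\<nu> * t) = cosh \<bar>\<nu> * t\<bar>" "cosh (\<mu> * t) = cosh \<bar>\<mu> * t\<bar>" by simp_all
    moreover have "\<bar>\<nu> * t\<bar> \<le> \<bar>\<mu> * t\<bar>" using assms(2) by (simp add: abs_mult mult_right_mono)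
    ultimately show ?thesis using cosh_real_nonneg_le_iff by (metis abs_ge_zero)
  qed
  have i: "set_integrable lborel {0<..} (\<lambda>t. exp (- x * cosh t) * cosh (\<nu> * t))" for \<nu>
    unfolding set_integrable_def
    by (rule integrable_mult_indicator) (use integrable_exp_cosh_cosh[OF assms(1)] in simp_all)
  show ?thesis
    unfolding bessel_K_def interval_lebesgue_integral_0_infty
    by (rule set_integral_mono[OF i i]) (auto intro: c)
qed

section \<open>Derivative and recurrence of K\<close>

lemma exp_Taylor_bound: "\<bar>exp z - 1 - z\<bar> \<le> z\<^sup>2 * exp \<bar>z\<bar>" for z :: real
proof -
  obtain t where t: "\<bar>t\<bar> \<le> \<bar>z\<bar>" "exp z = (\<Sum>m<2. z ^ m / fact m) + exp t / fact 2 * z ^ 2"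
    using Maclaurin_exp_le[of z 2] by blast
  have "exp z - 1 - z = exp t / 2 * z\<^sup>2"
    using t(2) by (simp add: numeral_2_eq_2)
  then have "\<bar>exp z - 1 - z\<bar> = exp t / 2 * z\<^sup>2" by (simp only: abs_mult) simp
  also have "\<dots> \<le> exp \<bar>z\<bar> * z\<^sup>2"
  proof (rule mult_right_mono)
    have "exp t \<le> exp \<bar>z\<bar>" using t(1) by simp
    then show "exp t / 2 \<le> exp \<bar>z\<bar>" using exp_gt_zero[of t] by linarith
  qed simp
  finally show ?thesis by (simp add: mult.commute)
qed

text \<open>Differentiation under the integral sign with an explicit remainder of order h^2. The
  factor cosh t that comes down is half the sum of the two order shifts.\<close>

lemma bessel_K_deriv:
  assumes x: "x > 0"
  shows "(bessel_K \<nu> has_real_derivative - (bessel_K (\<nu> + 1) x + bessel_K (\<nu> - 1) x) / 2) (at x)"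
proof -
  let ?e = "\<lambda>x \<nu> t. exp (- x * cosh t) * exp (\<nu> * t)"
  let ?D = "- (bessel_K (\<nu> + 1) x + bessel_K (\<nu> - 1) x) / 2"
  have int: "integrable lborel (?e y \<mu>)" if "y > 0" for y \<mu> :: real by (rule integrable_exp_cosh[OF that])
  have c1: "cosh t * ?e y \<mu> t = (?e y (\<mu> + 1) t + ?e y (\<mu> - 1) t) / 2" for y \<mu> t :: real
    by (simp add: cosh_def field_simps exp_add exp_diff exp_minus)
  have int1: "integrable lborel (\<lambda>t. cosh t * ?e y \<mu> t)" if "y > 0" for y \<mu> :: real
    unfolding c1 by (intro integrable_divide Bochner_Integration.integrable_add int that)
  have c2: "(cosh t)\<^sup>2 * ?e y \<mu> t = (cosh t * ?e y (\<mu> + 1) t + cosh t * ?e y (\<mu> - 1) t) / 2" for y \<mu> t :: real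
    using c1[of t y \<mu>] by (simp add: power2_eq_square field_simps)
  have int2: "integrable lborel (\<lambda>t. (cosh t)\<^sup>2 * ?e y \<mu> t)" if "y > 0" for y \<mu> :: real
    unfolding c2 by (intro integrable_divide Bochner_Integration.integrable_add int1 that)
  \<comment> \<open>For |h| <= x/2 the factor exp(|h| cosh t) of the Taylor remainder uses up at
    most half of exp(-x cosh t); hence the majorant is taken at x/2.\<close>
  define N where "N = (\<integral>t. (cosh t)\<^sup>2 * ?e (x/2) \<nu> t \<partial>lborel)"
  have N0: "0 \<le> N" unfolding N_def by (intro integral_nonneg_AE AE_I2) simp
  have D: "?D = - (\<integral>t. cosh t * ?e x \<nu> t \<partial>lborel) / 2"
    unfolding c1 using int[OF x] x by (simp add: bessel_K_whole_line add_divide_distrib)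
  have est: "\<bar>bessel_K \<nu> (x + h) - bessel_K \<nu> x - h * ?D\<bar> \<le> h\<^sup>2 * N" if h: "\<bar>h\<bar> \<le> x / 2" for h
  proof -
    have xh: "x + h > 0" using h x by (auto simp: abs_if split: if_splits)
    have eq: "bessel_K \<nu> (x + h) - bessel_K \<nu> x - h * ?D
        = (\<integral>t. ?e (x + h) \<nu> t - ?e x \<nu> t + h * (cosh t * ?e x \<nu> t) \<partial>lborel) / 2"
    proof -
      have "(\<integral>t. ?e (x + h) \<nu> t - ?e x \<nu> t + h * (cosh t * ?e x \<nu> t) \<partial>lborel)
          = (\<integral>t. ?e (x + h) \<nu> t \<partial>lborel) - (\<integral>t. ?e x \<nu> t \<partial>lborel) + h * (\<integral>t. cosh t * ?e x \<nu> t \<partial>lborel)"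
        using int[OF x, of \<nu>] int[OF xh, of \<nu>] int1[OF x, of \<nu>] by simp
      moreover have "h * ?D = - (h * (\<integral>t. cosh t * ?e x \<nu> t \<partial>lborel)) / 2"
        unfolding D by simp
      ultimately show ?thesis
        using bessel_K_whole_line[OF x, of \<nu>] bessel_K_whole_line[OF xh, of \<nu>] by linarith
    qed
    have le: "\<bar>\<integral>t. ?e (x + h) \<nu> t - ?e x \<nu> t + h * (cosh t * ?e x \<nu> t) \<partial>lborel\<bar>
        \<le> (\<integral>t. h\<^sup>2 * ((cosh t)\<^sup>2 * ?e (x/2) \<nu> t) \<partial>lborel)"
    proof (rule order_trans[OF integral_abs_bound integral_mono])
      show "integrable lborel (\<lambda>t. \<bar>?e (x + h) \<nu> t - ?e x \<nu> t + h * (cosh t * ?e x \<nu> t)\<bar>)"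
        using int[OF x, of \<nu>] int[OF xh, of \<nu>] int1[OF x, of \<nu>] by simp
      show "integrable lborel (\<lambda>t. h\<^sup>2 * ((cosh t)\<^sup>2 * ?e (x/2) \<nu> t))"
        using int2[of "x/2" \<nu>] x by simp
      fix t :: real
      let ?z = "- h * cosh t"
      have "?e (x + h) \<nu> t - ?e x \<nu> t + h * (cosh t * ?e x \<nu> t)
          = ?e x \<nu> t * (exp ?z - 1 - ?z)"
        by (simp add: algebra_simps flip: exp_add)
      then have "\<bar>?e (x + h) \<nu> t - ?e x \<nu> t + h * (cosh t * ?e x \<nu> t)\<bar>
          = ?e x \<nu> t * \<bar>exp ?z - 1 - ?z\<bar>"
        by (simp add: abs_mult)
      also have "\<dots> \<le> ?e x \<nu> t * (?z\<^sup>2 * exp \<bar>?z\<bar>)"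
        by (intro mult_left_mono exp_Taylor_bound) simp
      also have "\<dots> \<le> ?e x \<nu> t * (?z\<^sup>2 * exp (x / 2 * cosh t))"
      proof -
        have "\<bar>?z\<bar> \<le> x / 2 * cosh t" using h by (simp add: abs_mult mult_right_mono)
        then show ?thesis by (intro mult_left_mono) simp_all
      qed
      also have "\<dots> = h\<^sup>2 * ((cosh t)\<^sup>2 * ?e (x/2) \<nu> t)"
      proof -
        have "exp (- x * cosh t) * exp (x / 2 * cosh t) = exp (- (x/2) * cosh t)"
          by (simp add: field_simps flip: exp_add)
        then show ?thesis by (simp add: power2_eq_square)
      qed
      finally show "\<bar>?e (x + h) \<nu> t - ?e x \<nu> t + h * (cosh t * ?e x \<nu> t)\<bar>
          \<le> h\<^sup>2 * ((cosh t)\<^sup>2 * ?e (x/2) \<nu> t)" .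
    qed
    have "(\<integral>t. h\<^sup>2 * ((cosh t)\<^sup>2 * ?e (x/2) \<nu> t) \<partial>lborel) = h\<^sup>2 * N"
      unfolding N_def by (rule integral_mult_right_zero)
    moreover have "0 \<le> h\<^sup>2 * N" using N0 by simp
    ultimately show ?thesis using le unfolding eq by linarith
  qed
  have "(\<lambda>h. (bessel_K \<nu> (x + h) - bessel_K \<nu> x) / h - ?D) \<midarrow>0\<rightarrow> 0"
  proof (rule Lim_null_comparison)
    have "eventually (\<lambda>h. \<bar>h\<bar> < x / 2 \<and> h \<noteq> 0) (at (0::real))"
      using x by (auto simp: eventually_at intro!: exI[of _ "x/2"])
    then show "\<forall>\<^sub>F h in at 0. norm ((bessel_K \<nu> (x + h) - bessel_K \<nu> x) / h - ?D) \<le> \<bar>h\<bar> * N"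
    proof eventually_elim
      case (elim h)
      have "norm ((bessel_K \<nu> (x + h) - bessel_K \<nu> x) / h - ?D)
          = \<bar>bessel_K \<nu> (x + h) - bessel_K \<nu> x - h * ?D\<bar> / \<bar>h\<bar>"
        using elim by (simp add: diff_divide_distrib flip: abs_divide)
      also have "\<dots> \<le> (h\<^sup>2 * N) / \<bar>h\<bar>"
        using est[of h] elim by (intro divide_right_mono) simp_all
      also have "\<dots> = \<bar>h\<bar> * N"
        using elim by (simp add: power2_eq_square abs_if)
      finally show ?case .
    qed
    show "(\<lambda>h. \<bar>h\<bar> * N) \<midarrow>0\<rightarrow> 0" by (auto intro!: tendsto_eq_intros)
  qed
  then show ?thesis
    unfolding DERIV_def by (rule LIM_zero_cancel)
qed

text \<open>\<open>?f\<close> is the derivative in t of exp(-x cosh t) exp(nu t), which vanishes at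
  both ends of the line, so its integral is 0. The factor sinh t is half the difference of the two
  order shifts.\<close>

lemma bessel_K_recurrence:
  assumes x: "x > 0"
  shows "bessel_K (\<nu> + 1) x = bessel_K (\<nu> - 1) x + 2 * \<nu> / x * bessel_K \<nu> x"
proof -
  let ?e = "\<lambda>\<nu> t. exp (- x * cosh t) * exp (\<nu> * t)"
  let ?f = "\<lambda>t. \<nu> * ?e \<nu> t - x * ((?e (\<nu> + 1) t - ?e (\<nu> - 1) t) / 2)"
  have int: "integrable lborel ?f"
    by (intro Bochner_Integration.integrable_diff integrable_mult_right integrable_divide integrable_exp_cosh x)
  have lim: "(?e \<nu> \<longlongrightarrow> 0) F" if "filterlim (\<lambda>t. - \<bar>t\<bar>) at_bot F" for F
  proof (rule Lim_null_comparison)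
    show "\<forall>\<^sub>F t in F. norm (?e \<nu> t) \<le> exp ((\<bar>\<nu>\<bar> + 1)\<^sup>2 / x) * exp (- \<bar>t\<bar>)"
      using exp_cosh_bound[OF x] by simp
    show "((\<lambda>t. exp ((\<bar>\<nu>\<bar> + 1)\<^sup>2 / x) * exp (- \<bar>t\<bar>)) \<longlongrightarrow> 0) F"
      by (intro tendsto_mult_right_zero filterlim_compose[OF exp_at_bot that])
  qed
  have top: "filterlim (\<lambda>t::real. - \<bar>t\<bar>) at_bot at_top"
    by (subst filterlim_cong[OF refl refl, of _ uminus])
      (auto simp: eventually_at_top_linorder filterlim_uminus_at_bot_at_top intro!: exI[of _ 0])
  have bot: "filterlim (\<lambda>t::real. - \<bar>t\<bar>) at_bot at_bot"
    by (subst filterlim_cong[OF refl refl, of _ "\<lambda>t. t"])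
      (auto simp: eventually_at_bot_linorder filterlim_ident intro!: exI[of _ 0])
  have "(LBINT t=-\<infinity>..\<infinity>. ?f t) = 0 - 0"
  proof (rule interval_integral_FTC_integrable[where F = "?e \<nu>"])
    fix t :: real
    have "(?e \<nu> has_real_derivative ?f t) (at t)"
      by (auto intro!: derivative_eq_intros simp: sinh_def field_simps exp_add exp_diff exp_minus)
    then show "(?e \<nu> has_vector_derivative ?f t) (at t)"
      by (simp add: has_real_derivative_iff_has_vector_derivative)
    have "continuous_on UNIV ?f" by (intro continuous_on_diff continuous_on_mult continuous_on_divide continuous_intros) simp
    then show "isCont ?f t" by (simp add: continuous_on_eq_continuous_at)
  next
    show "set_integrable lborel (einterval (- \<infinity>) \<infinity>) ?f"
      using int by (simp add: set_integrable_def einterval_def)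
    show "((?e \<nu> \<circ> real_of_ereal) \<longlongrightarrow> 0) (at_right (- \<infinity>))"
      unfolding ereal_tendsto_simps by (rule lim[OF bot])
    show "((?e \<nu> \<circ> real_of_ereal) \<longlongrightarrow> 0) (at_left \<infinity>)"
      unfolding ereal_tendsto_simps by (rule lim[OF top])
  qed simp
  then have "(\<integral>t. ?f t \<partial>lborel) = 0"
    by (simp add: interval_lebesgue_integral_def set_lebesgue_integral_def einterval_def)
  moreover have "(\<integral>t. ?f t \<partial>lborel)
      = 2 * \<nu> * bessel_K \<nu> x - x * (bessel_K (\<nu> + 1) x - bessel_K (\<nu> - 1) x)"
    using integrable_exp_cosh[OF x] by (simp add: bessel_K_whole_line[OF x])
  ultimately show ?thesis using x by (simp add: field_simps)
qed

text \<open>Eliminating one neighbouring order leaves a term nu/x that cancels when x^(-nu) K_nu is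
  differentiated; \<open>bessel_K_deriv_down\<close> is the form that suits x^nu K_nu.\<close>

lemma bessel_K_deriv_up:
  assumes "x > 0"
  shows "(bessel_K \<nu> has_real_derivative \<nu> / x * bessel_K \<nu> x - bessel_K (\<nu> + 1) x) (at x)"
  by (rule DERIV_cong[OF bessel_K_deriv[OF assms]])
    (use bessel_K_recurrence[OF assms, of \<nu>] in \<open>simp add: field_simps\<close>)

lemma bessel_K_deriv_down:
  assumes "x > 0"
  shows "(bessel_K \<nu> has_real_derivative - \<nu> / x * bessel_K \<nu> x - bessel_K (\<nu> - 1) x) (at x)"
  by (rule DERIV_cong[OF bessel_K_deriv[OF assms]])
    (use bessel_K_recurrence[OF assms, of \<nu>] in \<open>simp add: field_simps\<close>)

text \<open>Dropping the decaying half of \<open>cosh\<close> and substituting \<open>w = (x / 2) e\<^sup>t\<close> gives Euler's integral.\<close>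

lemma bessel_K_le_Gamma:
  assumes x: "x > 0" and \<mu>: "\<mu> > 0"
  shows "x powr \<mu> * bessel_K \<mu> x \<le> 2 powr (\<mu> - 1) * Gamma \<mu>"
proof -
  define c where "c = x / 2"
  have c: "c > 0" using x by (simp add: c_def)
  let ?f = "\<lambda>t. exp (- c * exp t) * exp (\<mu> * t)"
  let ?h = "\<lambda>w. w powr (\<mu> - 1) / exp w"
  have Gi: "set_integrable lborel {0<..} ?h" and GI: "(LBINT w:{0<..}. ?h w) = Gamma \<mu>"
  proof -
    have hi: "(?h has_integral Gamma \<mu>) {0<..}"
      using Gamma_integral_real[OF \<mu>]
      by (subst has_integral_spike_set_eq[where T = "{0..}"])
        (auto intro: negligible_subset[OF negligible_sing[of 0]])
    then have "?h absolutely_integrable_on {0<..}"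
      by (intro nonnegative_absolutely_integrable_1) (auto simp: has_integral_iff)
    then show *: "set_integrable lborel {0<..} ?h"
      by (simp add: absolutely_integrable_on_def set_integrable_def integrable_completion)
    show "(LBINT w:{0<..}. ?h w) = Gamma \<mu>"
      using set_borel_integral_eq_integral(2)[OF *] hi by (simp add: integral_unique)
  qed
  have sub: "?f (ln (w / c)) * (1 / w) = c powr (- \<mu>) * ?h w" if "w > 0" for w
  proof -
    have "exp (\<mu> * ln (w / c)) = w powr \<mu> * c powr (- \<mu>)"
      using that c by (simp add: powr_def ln_div field_simps flip: exp_add)
    moreover have "w powr \<mu> / w = w powr (\<mu> - 1)"
      using that by (simp add: powr_diff)
    moreover have "exp (- c * exp (ln (w / c))) = inverse (exp w)"
      using that c by (simp add: exp_minus)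
    ultimately show ?thesis using that by (simp add: field_simps)
  qed
  have lim0: "((ereal \<circ> (\<lambda>w. ln (w / c)) \<circ> real_of_ereal) \<longlongrightarrow> - \<infinity>) (at_right (ereal 0))"
  proof -
    have "filterlim (\<lambda>w. ln (w / c)) at_bot (at_right 0)"
    proof (rule filterlim_compose[OF ln_at_0])
      show "filterlim (\<lambda>w. w / c) (at_right 0) (at_right 0)"
        unfolding filterlim_at
        using c by (auto intro!: tendsto_eq_intros simp: eventually_at_filter)
    qed
    then show ?thesis by (simp add: ereal_tendsto_simps)
  qed
  have liminf: "((ereal \<circ> (\<lambda>w. ln (w / c)) \<circ> real_of_ereal) \<longlongrightarrow> \<infinity>) (at_left \<infinity>)"
  proof -
    have "filterlim (\<lambda>w. w * inverse c) at_top at_top"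
      using c by (intro filterlim_at_top_mult_tendsto_pos[OF tendsto_const _ filterlim_ident]) auto
    then have "filterlim (\<lambda>w. ln (w / c)) at_top at_top"
      by (intro filterlim_compose[OF ln_at_top]) (simp add: divide_inverse)
    then show ?thesis by (simp add: ereal_tendsto_simps)
  qed
  have si: "set_integrable lborel (einterval (ereal 0) \<infinity>) (\<lambda>w. ?f (ln (w / c)) * (1 / w))"
  proof -
    have "set_integrable lborel {0<..} (\<lambda>w. c powr (- \<mu>) * ?h w)"
      using Gi by (intro set_integrable_mult_right)
    also have "?this \<longleftrightarrow> set_integrable lborel {0<..} (\<lambda>w. ?f (ln (w / c)) * (1 / w))"
      by (intro set_integrable_cong refl) (simp only: greaterThan_iff sub)
    finally show ?thesis by (simp add: einterval_def greaterThan_def)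
  qed
  have deriv: "((\<lambda>w. ln (w / c)) has_real_derivative 1 / w) (at w)" if "ereal 0 < ereal w" for w
    using that c by (auto intro!: derivative_eq_intros simp: field_simps)
  have "isCont ?f t" for t by (intro continuous_intros)
  moreover have "isCont (\<lambda>w::real. 1 / w) w" if "ereal 0 < ereal w" for w
    using that by (intro continuous_intros) simp
  ultimately have sub_thm: "set_integrable lborel (einterval (- \<infinity>) \<infinity>) ?f"
    "(LBINT t=-\<infinity>..\<infinity>. ?f t) = (LBINT w=ereal 0..\<infinity>. ?f (ln (w / c)) * (1 / w))"
    by (intro interval_integral_substitution_nonneg[where g = "\<lambda>w. ln (w / c)" and g' = "\<lambda>w. 1 / w",
          OF _ deriv _ _ _ _ lim0 liminf si]; force)+
  from sub_thm have fi: "integrable lborel ?f"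
    and fI: "(\<integral>t. ?f t \<partial>lborel) = (LBINT w=ereal 0..\<infinity>. ?f (ln (w / c)) * (1 / w))"
    by (simp_all add: interval_lebesgue_integral_def set_lebesgue_integral_def einterval_def
        set_integrable_def)
  have "(LBINT w=ereal 0..\<infinity>. ?f (ln (w / c)) * (1 / w)) = (LBINT w:{0<..}. c powr (- \<mu>) * ?h w)"
    unfolding interval_integral_to_infinity_eq
    by (rule set_lebesgue_integral_cong) (simp, intro allI impI, rule sub, simp)
  also have "\<dots> = c powr (- \<mu>) * Gamma \<mu>"
    by (simp only: set_integral_mult_right GI)
  finally have val: "(\<integral>t. ?f t \<partial>lborel) = c powr (- \<mu>) * Gamma \<mu>"
    using fI by simp
  have "(\<integral>t. exp (- x * cosh t) * exp (\<mu> * t) \<partial>lborel) \<le> (\<integral>t. ?f t \<partial>lborel)"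
  proof (rule integral_mono[OF integrable_exp_cosh[OF x] fi])
    fix t :: real
    have "c * exp t \<le> x * cosh t" using x by (simp add: c_def cosh_def field_simps)
    then show "exp (- x * cosh t) * exp (\<mu> * t) \<le> ?f t" by (intro mult_right_mono) simp_all
  qed
  then have "bessel_K \<mu> x \<le> c powr (- \<mu>) * Gamma \<mu> / 2"
    using val by (simp add: bessel_K_whole_line[OF x])
  then have "x powr \<mu> * bessel_K \<mu> x \<le> x powr \<mu> * (c powr (- \<mu>) * Gamma \<mu> / 2)"
    by (intro mult_left_mono) simp_all
  also have "\<dots> = 2 powr (\<mu> - 1) * Gamma \<mu>"
    using x by (simp add: c_def powr_divide powr_minus powr_diff field_simps)
  finally show ?thesis .
qed

text \<open>Compares with the integral at 1 through cosh t >= 1. It supplies the limits at infinity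
  in \<open>bessel_K_order_gap\<close>.\<close>

lemma bessel_K_exp_decay:
  assumes "x \<ge> 1"
  shows "bessel_K \<nu> x \<le> exp (1 - x) * bessel_K \<nu> 1"
proof -
  have "(\<integral>t. exp (- x * cosh t) * exp (\<nu> * t) \<partial>lborel)
      \<le> (\<integral>t. exp (1 - x) * (exp (- 1 * cosh t) * exp (\<nu> * t)) \<partial>lborel)"
  proof (rule integral_mono)
    fix t :: real
    have "x - 1 \<le> (x - 1) * cosh t"
      using mult_left_mono[OF cosh_real_ge_1[of t], of "x - 1"] assms by simp
    then have "exp (- x * cosh t) \<le> exp (1 - x) * exp (- 1 * cosh t)"
      by (simp add: algebra_simps flip: exp_add)
    then show "exp (- x * cosh t) * exp (\<nu> * t) \<le> exp (1 - x) * (exp (- 1 * cosh t) * exp (\<nu> * t))"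
      by (simp add: mult_right_mono flip: mult.assoc)
  qed (use assms integrable_exp_cosh[of x \<nu>] integrable_exp_cosh[of 1 \<nu>] in simp_all)
  then show ?thesis using assms by (simp add: bessel_K_whole_line)
qed

section \<open>The Bessel function I and products of Bessel functions\<close>

text \<open>The Bessel-Clifford function: the entire factor of I_nu in the variable y = (x/2)^2. Its
  derivative is the same series with the order raised by one, so termwise differentiation gives the
  derivative of I directly.\<close>

definition bessel_series :: "real \<Rightarrow> real \<Rightarrow> real" where
  "bessel_series \<nu> y = (\<Sum>k. rGamma (\<nu> + real k + 1) / fact k * y ^ k)"

lemma rGamma_shift: "rGamma (\<nu> + real (Suc k) + 1) * (\<nu> + real k + 1) = rGamma (\<nu> + real k + 1)"
  using rGamma_plus1[of "\<nu> + real k + 1"] by (simp add: algebra_simps)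

lemma rGamma_real_nonneg: "x > 0 \<Longrightarrow> rGamma x \<ge> (0::real)"
  by (simp add: rGamma_inverse_Gamma)

lemma summable_bessel_series:
  assumes \<nu>: "\<nu> > -1"
  shows "summable (\<lambda>k. rGamma (\<nu> + real k + 1) / fact k * y ^ k)"
\<comment> \<open>From this index on, nu + k + 1 >= 1, so the reciprocal Gamma factors do not grow,
  and |y| / (k+1) <= 1/2.\<close>
proof (rule summable_ratio_test[of "1/2" "nat \<lceil>2 * \<bar>y\<bar>\<rceil> + 1"])
  fix k assume k: "nat \<lceil>2 * \<bar>y\<bar>\<rceil> + 1 \<le> k"
  define z where "z = \<nu> + real k + 1"
  have z: "z \<ge> 1" using k \<nu> by (simp add: z_def)
  have yk: "2 * \<bar>y\<bar> \<le> real k + 1" using k by linarith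
  have "rGamma (\<nu> + real (Suc k) + 1) * z = rGamma z"
    unfolding z_def by (rule rGamma_shift)
  moreover have "0 \<le> rGamma (\<nu> + real (Suc k) + 1)"
    using \<nu> by (intro rGamma_real_nonneg) simp
  ultimately have "rGamma (\<nu> + real (Suc k) + 1) \<le> rGamma z"
    using z mult_left_mono[of 1 z "rGamma (\<nu> + real (Suc k) + 1)"] by simp
  moreover have "\<bar>y\<bar> / (real k + 1) \<le> 1 / 2" using yk by (simp add: field_simps)
  ultimately have "rGamma (\<nu> + real (Suc k) + 1) * (\<bar>y\<bar> / (real k + 1)) \<le> rGamma z * (1 / 2)"
    using z by (intro mult_mono) (auto intro: rGamma_real_nonneg)
  then have "rGamma (\<nu> + real (Suc k) + 1) * (\<bar>y\<bar> / (real k + 1)) * (\<bar>y\<bar> ^ k / fact k)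
      \<le> rGamma z * (1 / 2) * (\<bar>y\<bar> ^ k / fact k)"
    by (rule mult_right_mono) simp
  moreover have "norm (rGamma (\<nu> + real (Suc k) + 1) / fact (Suc k) * y ^ Suc k)
      = rGamma (\<nu> + real (Suc k) + 1) * (\<bar>y\<bar> / (real k + 1)) * (\<bar>y\<bar> ^ k / fact k)"
    using \<nu> rGamma_real_nonneg[of "\<nu> + real (Suc k) + 1"]
    by (simp add: abs_mult power_abs field_simps)
  moreover have "norm (rGamma (\<nu> + real k + 1) / fact k * y ^ k) = rGamma z * (\<bar>y\<bar> ^ k / fact k)"
    using z rGamma_real_nonneg[of z] by (simp add: z_def abs_mult power_abs)
  ultimately show "norm (rGamma (\<nu> + real (Suc k) + 1) / fact (Suc k) * y ^ Suc k)
      \<le> 1 / 2 * norm (rGamma (\<nu> + real k + 1) / fact k * y ^ k)"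
    by simp
qed simp

lemma bessel_series_deriv:
  assumes "\<nu> > -1"
  shows "(bessel_series \<nu> has_real_derivative bessel_series (\<nu> + 1) y) (at y)"
proof -
  let ?c = "\<lambda>k. rGamma (\<nu> + real k + 1) / fact k"
  have "diffs ?c k = rGamma (\<nu> + 1 + real k + 1) / fact k" for k
  proof -
    have "\<nu> + real (Suc k) + 1 = \<nu> + 1 + real k + 1" by simp
    then have "rGamma (\<nu> + real (Suc k) + 1) = rGamma (\<nu> + 1 + real k + 1)" by (rule arg_cong)
    then show ?thesis by (simp only: diffs_def fact_Suc) simp
  qed
  then have "(\<Sum>k. diffs ?c k * y ^ k) = bessel_series (\<nu> + 1) y"
    by (simp add: bessel_series_def)
  then show ?thesis
    using termdiffs_strong_converges_everywhere[of ?c y, OF summable_bessel_series[OF assms]]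
    by (simp add: bessel_series_def[abs_def])
qed

text \<open>Coefficientwise, 1/Gamma(nu+k+1) = (nu+1+k)/Gamma(nu+k+2). The summand nu+1 gives the
  first series; the summand k cancels against k!, shifts the index and gives y times the
  second.\<close>

lemma bessel_series_recurrence:
  assumes "\<nu> > -1"
  shows "bessel_series \<nu> y = (\<nu> + 1) * bessel_series (\<nu> + 1) y + y * bessel_series (\<nu> + 2) y"
proof -
  let ?t = "\<lambda>\<nu> k. rGamma (\<nu> + real k + 1) / fact k * y ^ k"
  have s: "summable (?t \<nu>)" "summable (?t (\<nu> + 1))" "summable (?t (\<nu> + 2))"
    using assms by (intro summable_bessel_series; simp)+
  have e: "?t \<nu> (Suc k) = (\<nu> + 1) * ?t (\<nu> + 1) (Suc k) + y * ?t (\<nu> + 2) k" for k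
  proof -
    let ?r = "rGamma (\<nu> + real (Suc (Suc k)) + 1)"
    have "rGamma (\<nu> + real (Suc k) + 1) = ?r * (\<nu> + real (Suc k) + 1)"
      using rGamma_shift[of \<nu> "Suc k"] by simp
    moreover have "rGamma (\<nu> + 1 + real (Suc k) + 1) = ?r" "rGamma (\<nu> + 2 + real k + 1) = ?r"
      by (simp_all add: add_ac)
    moreover have "fact (Suc k) = real (Suc k) * fact k" by simp
    ultimately show ?thesis by (simp add: field_simps del: of_nat_Suc fact_Suc)
  qed
  have z: "?t \<nu> 0 = (\<nu> + 1) * ?t (\<nu> + 1) 0"
    using rGamma_shift[of \<nu> 0] by (simp add: add_ac mult_ac)
  have "bessel_series \<nu> y = ?t \<nu> 0 + (\<Sum>k. ?t \<nu> (Suc k))"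
    unfolding bessel_series_def using suminf_split_head[OF s(1)] by linarith
  also have "(\<Sum>k. ?t \<nu> (Suc k)) = (\<nu> + 1) * (\<Sum>k. ?t (\<nu> + 1) (Suc k)) + y * (\<Sum>k. ?t (\<nu> + 2) k)"
  proof -
    have s2: "summable (\<lambda>k. ?t (\<nu> + 1) (Suc k))"
      using s(2) by (subst summable_Suc_iff)
    show ?thesis
      unfolding e suminf_add[OF summable_mult[OF s2] summable_mult[OF s(3)], symmetric]
        suminf_mult[OF s2] suminf_mult[OF s(3)] ..
  qed
  also have "(\<Sum>k. ?t (\<nu> + 1) (Suc k)) = bessel_series (\<nu> + 1) y - ?t (\<nu> + 1) 0"
    unfolding bessel_series_def by (rule suminf_split_head[OF s(2)])
  finally show ?thesis unfolding z by (simp add: bessel_series_def algebra_simps)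
qed

lemma bessel_series_0: "bessel_series \<nu> 0 = rGamma (\<nu> + 1)"
  unfolding bessel_series_def by (subst suminf_finite[of "{0}"]) auto

lemma bessel_series_pos:
  assumes "\<nu> > -1" "y \<ge> 0"
  shows "bessel_series \<nu> y > 0"
  unfolding bessel_series_def
proof (rule suminf_pos2[OF summable_bessel_series[OF assms(1)], where i = 0])
  show "0 \<le> rGamma (\<nu> + real k + 1) / fact k * y ^ k" for k
    using assms by (intro mult_nonneg_nonneg divide_nonneg_nonneg rGamma_real_nonneg) auto
  show "0 < rGamma (\<nu> + real 0 + 1) / fact 0 * y ^ 0"
    using assms by (simp add: rGamma_inverse_Gamma)
qed

lemma bessel_I_series:
  assumes "\<nu> > -1" "x > 0"
  shows "bessel_I \<nu> x = (x / 2) powr \<nu> * bessel_series \<nu> ((x / 2)\<^sup>2)"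
proof -
  have "(x / 2) powr (\<nu> + 2 * real k) / (fact k * Gamma (\<nu> + real k + 1))
      = (x / 2) powr \<nu> * (rGamma (\<nu> + real k + 1) / fact k * ((x / 2)\<^sup>2) ^ k)" for k
  proof -
    have "(x / 2) powr (2 * real k) = ((x / 2)\<^sup>2) ^ k"
      using assms powr_realpow[of "x / 2" "2 * k"] by (simp add: power_mult)
    then have "(x / 2) powr (\<nu> + 2 * real k) = (x / 2) powr \<nu> * ((x / 2)\<^sup>2) ^ k"
      by (simp only: powr_add)
    then show ?thesis by (simp only: rGamma_inverse_Gamma divide_inverse inverse_mult_distrib mult_ac)
  qed
  then show ?thesis
    unfolding bessel_I_def bessel_series_def
    using suminf_mult[OF summable_bessel_series[OF assms(1), of "(x / 2)\<^sup>2"], of "(x / 2) powr \<nu>"] by presburger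
qed

lemma bessel_I_pos: "\<nu> > -1 \<Longrightarrow> x > 0 \<Longrightarrow> bessel_I \<nu> x > 0"
  by (simp add: bessel_I_series bessel_series_pos)

lemma bessel_I_deriv_up:
  assumes \<nu>: "\<nu> > -1" and x: "x > 0"
  shows "(bessel_I \<nu> has_real_derivative \<nu> / x * bessel_I \<nu> x + bessel_I (\<nu> + 1) x) (at x)"
proof (rule has_field_derivative_transform_within_open[where S = "{0<..}"])
  have d: "((\<lambda>x. bessel_series \<nu> ((x / 2)\<^sup>2)) has_real_derivative
      x / 2 * bessel_series (\<nu> + 1) ((x / 2)\<^sup>2)) (at x)"
    by (rule DERIV_cong[OF DERIV_chain'[OF _ bessel_series_deriv[OF \<nu>]]])
      (auto intro!: derivative_eq_intros)
  have p: "((\<lambda>x. (x / 2) powr \<nu>) has_real_derivative \<nu> / x * (x / 2) powr \<nu>) (at x)"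
    using x by (auto intro!: derivative_eq_intros simp: powr_diff field_simps)
  have "x / 2 * (x / 2) powr \<nu> = (x / 2) powr (\<nu> + 1)"
    using x by (simp add: powr_add)
  then show "((\<lambda>x. (x / 2) powr \<nu> * bessel_series \<nu> ((x / 2)\<^sup>2)) has_real_derivative
      \<nu> / x * bessel_I \<nu> x + bessel_I (\<nu> + 1) x) (at x)"
    using \<nu> x by (intro DERIV_cong[OF DERIV_mult[OF p d]]) (simp add: bessel_I_series mult_ac)
qed (use x \<nu> in \<open>auto simp: bessel_I_series\<close>)

lemma bessel_I_recurrence:
  assumes \<nu>: "\<nu> > -1" and x: "x > 0"
  shows "bessel_I \<nu> x = 2 * (\<nu> + 1) / x * bessel_I (\<nu> + 1) x + bessel_I (\<nu> + 2) x"
proof -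
  have "(x / 2) powr (\<nu> + 1) = (x / 2) powr \<nu> * (x / 2)"
    "(x / 2) powr (\<nu> + 2) = (x / 2) powr \<nu> * (x / 2)\<^sup>2"
    using x by (simp_all add: powr_add power2_eq_square)
  then have "bessel_I (\<nu> + 1) x = (x / 2) powr \<nu> * (x / 2) * bessel_series (\<nu> + 1) ((x / 2)\<^sup>2)"
    "bessel_I (\<nu> + 2) x = (x / 2) powr \<nu> * (x / 2)\<^sup>2 * bessel_series (\<nu> + 2) ((x / 2)\<^sup>2)"
    using \<nu> x by (simp_all add: bessel_I_series)
  then show ?thesis
    unfolding bessel_I_series[OF \<nu> x] bessel_series_recurrence[OF \<nu>]
    using x by (simp add: field_simps)
qed

text \<open>Formulated for the order nu + 1, so that the lower order nu stays in the range nu > -1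
  of the series lemmas.\<close>

lemma bessel_I_deriv_down:
  assumes \<nu>: "\<nu> > -1" and x: "x > 0"
  shows "(bessel_I (\<nu> + 1) has_real_derivative bessel_I \<nu> x - (\<nu> + 1) / x * bessel_I (\<nu> + 1) x) (at x)"
proof (rule DERIV_cong)
  show "(bessel_I (\<nu> + 1) has_real_derivative
      (\<nu> + 1) / x * bessel_I (\<nu> + 1) x + bessel_I (\<nu> + 1 + 1) x) (at x)"
    using \<nu> x by (intro bessel_I_deriv_up) auto
  have "bessel_I (\<nu> + 1 + 1) x = bessel_I (\<nu> + 2) x" by (simp add: add.assoc)
  moreover have "2 * (\<nu> + 1) / x * bessel_I (\<nu> + 1) x = 2 * ((\<nu> + 1) / x * bessel_I (\<nu> + 1) x)" by simp
  ultimately show "(\<nu> + 1) / x * bessel_I (\<nu> + 1) x + bessel_I (\<nu> + 1 + 1) x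
      = bessel_I \<nu> x - (\<nu> + 1) / x * bessel_I (\<nu> + 1) x"
    using bessel_I_recurrence[OF \<nu> x] by linarith
qed

section \<open>Limits of I at 0, comparison of neighbouring orders, and the Wronskian\<close>

lemma tendsto_bessel_I_0:
  assumes \<nu>: "\<nu> > -1"
  shows "((\<lambda>x. x powr (- \<nu>) * bessel_I \<nu> x) \<longlongrightarrow> 1 / (2 powr \<nu> * Gamma (\<nu> + 1))) (at_right 0)"
proof -
  have "((\<lambda>x. 2 powr (- \<nu>) * bessel_series \<nu> ((x / 2)\<^sup>2)) \<longlongrightarrow> 2 powr (- \<nu>) * bessel_series \<nu> ((0 / 2)\<^sup>2)) (at_right 0)"
    by (intro tendsto_intros isCont_tendsto_compose[OF DERIV_isCont[OF bessel_series_deriv[OF \<nu>]]]) simp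
  moreover have "eventually (\<lambda>x. 2 powr (- \<nu>) * bessel_series \<nu> ((x / 2)\<^sup>2) = x powr (- \<nu>) * bessel_I \<nu> x) (at_right 0)"
  proof -
    have "2 powr (- \<nu>) * bessel_series \<nu> ((x / 2)\<^sup>2) = x powr (- \<nu>) * bessel_I \<nu> x" if "x > 0" for x
    proof -
      have "x powr (- \<nu>) * (x / 2) powr \<nu> = 2 powr (- \<nu>)"
        using that by (simp add: powr_divide powr_minus field_simps)
      then show ?thesis unfolding bessel_I_series[OF \<nu> that] by (simp only: mult.assoc[symmetric])
    qed
    then show ?thesis by (auto simp: eventually_at_filter)
  qed
  ultimately have "((\<lambda>x. x powr (- \<nu>) * bessel_I \<nu> x) \<longlongrightarrow> 2 powr (- \<nu>) * bessel_series \<nu> ((0 / 2)\<^sup>2)) (at_right 0)"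
    by (rule Lim_transform_eventually)
  moreover have "2 powr (- \<nu>) * bessel_series \<nu> ((0 / 2)\<^sup>2) = 1 / (2 powr \<nu> * Gamma (\<nu> + 1))"
    by (simp only: powr_minus bessel_series_0 rGamma_inverse_Gamma div_0 zero_power2
        inverse_eq_divide times_divide_times_eq mult_1)
  ultimately show ?thesis by simp
qed

lemma tendsto_powr_0_at_right: "a > 0 \<Longrightarrow> ((\<lambda>x::real. x powr a) \<longlongrightarrow> 0) (at_right 0)"
  by (rule tendsto_zero_powrI[OF tendsto_ident_at tendsto_const]) (auto simp: eventually_at_filter)

lemma tendsto_powr_bessel_I_0:
  assumes "\<nu> > -1" "a + \<nu> > 0"
  shows "((\<lambda>x. x powr a * bessel_I \<nu> x) \<longlongrightarrow> 0) (at_right 0)"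
proof -
  have "((\<lambda>x. x powr (a + \<nu>) * (x powr (- \<nu>) * bessel_I \<nu> x)) \<longlongrightarrow> 0 * (1 / (2 powr \<nu> * Gamma (\<nu> + 1)))) (at_right 0)"
    by (intro tendsto_mult tendsto_powr_0_at_right tendsto_bessel_I_0 assms)
  moreover have "x powr (a + \<nu>) * (x powr (- \<nu>) * bessel_I \<nu> x) = x powr a * bessel_I \<nu> x" for x
    by (simp flip: powr_add mult.assoc)
  ultimately show ?thesis by simp
qed

text \<open>The pattern of \<open>bessel_I_antimono_order\<close> and
  \<open>bessel_I_order_gap\<close>: a combination that tends to 0 at 0 and has a nonnegative
  derivative is nonnegative. A one-sided limit stands in for the value at 0, since the Bessel lemmas
  speak of positive arguments only.\<close>

lemma nondecreasing_from_at_right_0: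
  fixes f f' :: "real \<Rightarrow> real"
  assumes "\<And>x. x > 0 \<Longrightarrow> (f has_real_derivative f' x) (at x)"
    and "\<And>x. x > 0 \<Longrightarrow> f' x \<ge> 0"
    and "(f \<longlongrightarrow> L) (at_right 0)" and "x > 0"
  shows "L \<le> f x"
proof (rule tendsto_upperbound[OF assms(3)])
  show "\<forall>\<^sub>F s in at_right 0. f s \<le> f x"
  proof -
    have "f s \<le> f x" if "0 < s" "s < x" for s
    proof (rule DERIV_nonneg_imp_nondecreasing[of s x f])
      fix t assume "s \<le> t"
      then have "t > 0" using that by simp
      then show "\<exists>y. (f has_real_derivative y) (at t) \<and> 0 \<le> y" using assms(1,2) by blast
    qed (use that in simp)
    then show ?thesis unfolding eventually_at_right_field using assms(4) by blast
  qed
qed simp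

lemma DERIV_powr_pos:
  fixes x a :: real
  shows "x > 0 \<Longrightarrow> ((\<lambda>x. x powr a) has_real_derivative a / x * x powr a) (at x)"
  by (auto intro!: derivative_eq_intros simp: powr_diff)

lemma bessel_I_antimono_order:
  assumes \<nu>: "\<nu> > -1/2" and x: "x > 0"
  shows "bessel_I (\<nu> + 1) x \<le> bessel_I \<nu> x"
proof -
  \<comment> \<open>The weight e^x x^(nu+1) is an integrating factor: of the derivative of I_nu -
    I_{nu+1} only (2 nu + 1)/x I_nu survives, which is positive because nu > -1/2.\<close>
  let ?f = "\<lambda>x. exp x * x powr (\<nu> + 1) * (bessel_I \<nu> x - bessel_I (\<nu> + 1) x)"
  have "0 \<le> ?f x"
  proof (rule nondecreasing_from_at_right_0[OF _ _ _ x])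
    fix x :: real assume x: "x > 0"
    have n: "\<nu> > -1" using \<nu> by simp
    define A B P where "A = bessel_I \<nu>" and "B = bessel_I (\<nu> + 1)" and "P = (\<lambda>x. x powr (\<nu> + 1))"
    note d = bessel_I_deriv_up[OF n x] bessel_I_deriv_down[OF n x]
    note d' = d[folded A_def B_def]
    have dP: "(P has_real_derivative (\<nu> + 1) / x * P x) (at x)"
      unfolding P_def by (rule DERIV_powr_pos[OF x])
    have "((\<lambda>x. exp x * P x * (A x - B x)) has_real_derivative exp x * P x * ((2 * \<nu> + 1) / x * A x)) (at x)"
      using x by (auto intro!: derivative_eq_intros d' dP simp: field_simps)
    then show "(?f has_real_derivative exp x * x powr (\<nu> + 1) * ((2 * \<nu> + 1) / x * bessel_I \<nu> x)) (at x)"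
      by (simp only: A_def B_def P_def)
    show "0 \<le> exp x * x powr (\<nu> + 1) * ((2 * \<nu> + 1) / x * bessel_I \<nu> x)"
      using x \<nu> bessel_I_pos[OF n x] by simp
  next
    have "((\<lambda>x. exp x * (x powr (\<nu> + 1) * bessel_I \<nu> x - x powr (\<nu> + 1) * bessel_I (\<nu> + 1) x))
        \<longlongrightarrow> exp 0 * (0 - 0)) (at_right 0)"
      using \<nu> by (intro tendsto_intros tendsto_powr_bessel_I_0) auto
    then show "(?f \<longlongrightarrow> 0) (at_right 0)" by (simp add: algebra_simps)
  qed
  moreover have "0 < exp x * x powr (\<nu> + 1)" using x by simp
  ultimately have "0 \<le> bessel_I \<nu> x - bessel_I (\<nu> + 1) x" by (simp only: zero_le_mult_iff) linarith
  then show ?thesis by simp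
qed

text \<open>\<open>?W\<close> is constant, so it may be evaluated near 0. There s^(-nu) I_nu(s)
  tends to 1 / (2^nu Gamma(nu+1)), while s^(nu+1) K_{nu+1}(s) is at most 2^nu Gamma(nu+1) by Euler's
  integral. In the second product K_nu <= K_{nu+1} leaves a spare factor s. An upper bound on K is
  thus enough for the inequality.\<close>

lemma bessel_Wronskian_le_1:
  assumes \<nu>: "\<nu> > -1/2" and x: "x > 0"
  shows "x * (bessel_I \<nu> x * bessel_K (\<nu> + 1) x + bessel_I (\<nu> + 1) x * bessel_K \<nu> x) \<le> 1"
proof -
  let ?W = "\<lambda>x. x * (bessel_I \<nu> x * bessel_K (\<nu> + 1) x + bessel_I (\<nu> + 1) x * bessel_K \<nu> x)"
  let ?G = "2 powr \<nu> * Gamma (\<nu> + 1)"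
  have n: "\<nu> > -1" using \<nu> by simp
  have K1: "(bessel_K (\<nu> + 1) has_real_derivative - (\<nu> + 1) / x * bessel_K (\<nu> + 1) x - bessel_K \<nu> x) (at x)"
    if "x > 0" for x
    using bessel_K_deriv_down[OF that, of "\<nu> + 1"] by simp
  have "(?W has_real_derivative 0) (at x)" if x: "x > 0" for x
  proof -
    define A B C D where "A = bessel_I \<nu>" and "B = bessel_I (\<nu> + 1)"
      and "C = bessel_K \<nu>" and "D = bessel_K (\<nu> + 1)"
    note d = bessel_I_deriv_up[OF n x] bessel_I_deriv_down[OF n x] bessel_K_deriv_up[OF x, of \<nu>] K1[OF x]
    note d' = d[folded A_def B_def C_def D_def]
    have "((\<lambda>x. x * (A x * D x + B x * C x)) has_real_derivative 0) (at x)"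
      using x by (auto intro!: derivative_eq_intros d' simp: field_simps)
    then show ?thesis by (simp only: A_def B_def C_def D_def)
  qed
  then have const: "?W x = ?W s" if "s > 0" for s
    using that x by (cases "s \<le> x") (auto intro!: DERIV_isconst3[of 0 "x + s + 1" _ _ ?W])
  have up: "?W x \<le> s powr (- \<nu>) * bessel_I \<nu> s * ?G + s * (s powr (- (\<nu> + 1)) * bessel_I (\<nu> + 1) s * ?G)"
    if s: "s > 0" for s
  proof -
    have K: "s powr (\<nu> + 1) * bessel_K (\<nu> + 1) s \<le> ?G"
      using bessel_K_le_Gamma[OF s, of "\<nu> + 1"] n by simp
    have I: "bessel_I \<nu> s > 0" "bessel_I (\<nu> + 1) s > 0" using n s by (auto intro!: bessel_I_pos)
    have "?W s = s powr (- \<nu>) * bessel_I \<nu> s * (s powr (\<nu> + 1) * bessel_K (\<nu> + 1) s)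
       + s * (s powr (- (\<nu> + 1)) * bessel_I (\<nu> + 1) s * (s powr (\<nu> + 1) * bessel_K \<nu> s))"
      using s by (simp add: powr_add powr_minus powr_diff field_simps)
    moreover have "s powr (\<nu> + 1) * bessel_K \<nu> s \<le> s powr (\<nu> + 1) * bessel_K (\<nu> + 1) s"
      using \<nu> s by (intro mult_left_mono bessel_K_mono_order) auto
    then have K0: "s powr (\<nu> + 1) * bessel_K \<nu> s \<le> ?G" using K by linarith
    ultimately show ?thesis
      unfolding const[OF s] using K K0 I s
      by (auto intro!: add_mono mult_left_mono)
  qed
  have "((\<lambda>s. s powr (- \<nu>) * bessel_I \<nu> s * ?G + s * (s powr (- (\<nu> + 1)) * bessel_I (\<nu> + 1) s * ?G))
      \<longlongrightarrow> 1 / ?G * ?G + 0 * (1 / (2 powr (\<nu> + 1) * Gamma (\<nu> + 1 + 1)) * ?G)) (at_right 0)"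
    using n by (intro tendsto_intros tendsto_bessel_I_0) auto
  moreover have "1 / ?G * ?G = 1"
  proof -
    have "0 < Gamma (\<nu> + 1)" using n by (intro Gamma_real_pos) simp
    then have "?G \<noteq> 0" by simp
    then show ?thesis using nonzero_eq_divide_eq[of ?G "1 / ?G" 1] by blast
  qed
  ultimately have "((\<lambda>s. s powr (- \<nu>) * bessel_I \<nu> s * ?G + s * (s powr (- (\<nu> + 1)) * bessel_I (\<nu> + 1) s * ?G))
      \<longlongrightarrow> 1) (at_right 0)" by simp
  then show ?thesis
  proof (rule tendsto_lowerbound)
    show "\<forall>\<^sub>F s in at_right 0. ?W x \<le> s powr (- \<nu>) * bessel_I \<nu> s * ?G + s * (s powr (- (\<nu> + 1)) * bessel_I (\<nu> + 1) s * ?G)"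
      unfolding eventually_at_filter by (intro always_eventually) (use up in auto)
  qed simp
qed

text \<open>The quotient q = I_{nu+1} / I_nu solves q' = 1 - (2 nu + 1)/x q - q^2, so the claim is
  q' >= 0 with denominators cleared. In this form the difference of the two sides has derivative (2
  nu + 1)/x I_nu I_{nu+1} >= 0 and tends to 0 at 0.\<close>

lemma bessel_I_order_gap:
  assumes \<nu>: "\<nu> > -1/2" and x: "x > 0"
  shows "(2 * \<nu> + 1) * bessel_I \<nu> x * bessel_I (\<nu> + 1) x \<le> x * ((bessel_I \<nu> x)\<^sup>2 - (bessel_I (\<nu> + 1) x)\<^sup>2)"
proof -
  let ?f = "\<lambda>x. x * ((bessel_I \<nu> x)\<^sup>2 - (bessel_I (\<nu> + 1) x)\<^sup>2) - (2 * \<nu> + 1) * bessel_I \<nu> x * bessel_I (\<nu> + 1) x"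
  have n: "\<nu> > -1" "\<nu> + 1 > -1" using \<nu> by simp_all
  have "0 \<le> ?f x"
  proof (rule nondecreasing_from_at_right_0[OF _ _ _ x])
    fix x :: real assume x: "x > 0"
    define A B where "A = bessel_I \<nu>" and "B = bessel_I (\<nu> + 1)"
    note d = bessel_I_deriv_up[OF n(1) x] bessel_I_deriv_down[OF n(1) x]
    note d' = d[folded A_def B_def]
    have "((\<lambda>x. x * ((A x)\<^sup>2 - (B x)\<^sup>2) - (2 * \<nu> + 1) * A x * B x) has_real_derivative
        (2 * \<nu> + 1) / x * A x * B x) (at x)"
      using x by (auto intro!: derivative_eq_intros d' simp: field_simps power2_eq_square)
    then show "(?f has_real_derivative (2 * \<nu> + 1) / x * bessel_I \<nu> x * bessel_I (\<nu> + 1) x) (at x)"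
      by (simp only: A_def B_def)
    show "0 \<le> (2 * \<nu> + 1) / x * bessel_I \<nu> x * bessel_I (\<nu> + 1) x"
      using x \<nu> bessel_I_pos[OF n(1) x] bessel_I_pos[OF n(2) x] by simp
  next
    let ?h = "1/2 :: real"
    have "((\<lambda>x. (x powr ?h * bessel_I \<nu> x)\<^sup>2 - (x powr ?h * bessel_I (\<nu> + 1) x)\<^sup>2
        - (2 * \<nu> + 1) * (x powr 0 * bessel_I \<nu> x * bessel_I (\<nu> + 1) x)) \<longlongrightarrow> 0\<^sup>2 - 0\<^sup>2 - (2 * \<nu> + 1) * 0) (at_right 0)"
    proof (intro tendsto_intros tendsto_powr_bessel_I_0)
      have "((\<lambda>x. (x powr ?h * bessel_I \<nu> x) * (x powr (- ?h) * bessel_I (\<nu> + 1) x)) \<longlongrightarrow> 0 * 0) (at_right 0)"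
        using \<nu> by (intro tendsto_mult tendsto_powr_bessel_I_0) auto
      moreover have "(x powr ?h * bessel_I \<nu> x) * (x powr (- ?h) * bessel_I (\<nu> + 1) x)
          = x powr 0 * bessel_I \<nu> x * bessel_I (\<nu> + 1) x" for x
        by (simp add: powr_minus field_simps)
      ultimately show "((\<lambda>x. x powr 0 * bessel_I \<nu> x * bessel_I (\<nu> + 1) x) \<longlongrightarrow> 0) (at_right 0)" by simp
    qed (use \<nu> in auto)
    moreover have "eventually (\<lambda>x. (x powr ?h * bessel_I \<nu> x)\<^sup>2 - (x powr ?h * bessel_I (\<nu> + 1) x)\<^sup>2
        - (2 * \<nu> + 1) * (x powr 0 * bessel_I \<nu> x * bessel_I (\<nu> + 1) x) = ?f x) (at_right 0)"
      by (auto simp: eventually_at_filter power_mult_distrib powr_half_sqrt algebra_simps)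
    ultimately have "(?f \<longlongrightarrow> 0\<^sup>2 - 0\<^sup>2 - (2 * \<nu> + 1) * 0) (at_right 0)"
      by (rule Lim_transform_eventually)
    then show "(?f \<longlongrightarrow> 0) (at_right 0)" by simp
  qed
  then show ?thesis by simp
qed

text \<open>The counterpart for q = K_{nu-1} / K_nu, which solves q' = q^2 + (2 nu - 1)/x q - 1;
  again the claim is q' >= 0. The argument starts from infinity: the cleared difference is
  nonincreasing and tends to 0 there.\<close>

lemma bessel_K_order_gap:
  assumes \<nu>: "\<nu> \<ge> 1/2" and x: "x > 0"
  shows "x * (bessel_K \<nu> x)\<^sup>2 \<le> x * (bessel_K (\<nu> - 1) x)\<^sup>2 + (2 * \<nu> - 1) * bessel_K (\<nu> - 1) x * bessel_K \<nu> x"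
proof -
  let ?f = "\<lambda>x. x * ((bessel_K (\<nu> - 1) x)\<^sup>2 - (bessel_K \<nu> x)\<^sup>2) + (2 * \<nu> - 1) * bessel_K (\<nu> - 1) x * bessel_K \<nu> x"
  have K1: "(bessel_K (\<nu> - 1) has_real_derivative (\<nu> - 1) / x * bessel_K (\<nu> - 1) x - bessel_K \<nu> x) (at x)"
    if "x > 0" for x
    using bessel_K_deriv_up[OF that, of "\<nu> - 1"] by simp
  have d: "(?f has_real_derivative - ((2 * \<nu> - 1) / x * bessel_K (\<nu> - 1) x * bessel_K \<nu> x)) (at x)" if x: "x > 0" for x
  proof -
    define A B where "A = bessel_K (\<nu> - 1)" and "B = bessel_K \<nu>"
    note d = K1[OF x] bessel_K_deriv_down[OF x, of \<nu>]
    note d' = d[folded A_def B_def]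
    have "((\<lambda>x. x * ((A x)\<^sup>2 - (B x)\<^sup>2) + (2 * \<nu> - 1) * A x * B x) has_real_derivative
        - ((2 * \<nu> - 1) / x * A x * B x)) (at x)"
      using x by (auto intro!: derivative_eq_intros d' simp: field_simps power2_eq_square)
    then show ?thesis by (simp only: A_def B_def)
  qed
  have mono: "?f t \<le> ?f x" if "x \<le> t" for t
  proof (rule DERIV_nonpos_imp_nonincreasing[OF that])
    fix s assume "x \<le> s" "s \<le> t"
    then have "s > 0" using x by simp
    then show "\<exists>y. (?f has_real_derivative y) (at s) \<and> y \<le> 0"
      using d[OF \<open>s > 0\<close>] \<nu> bessel_K_nonneg[OF \<open>s > 0\<close>]
      by (intro exI[of _ "- ((2 * \<nu> - 1) / s * bessel_K (\<nu> - 1) s * bessel_K \<nu> s)"]) simp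
  qed
  \<comment> \<open>The limit with the extra factor t is needed because the squares in
    \<open>?f\<close> carry a factor x.\<close>
  have xK: "((\<lambda>t. t * bessel_K \<mu> t) \<longlongrightarrow> 0) at_top" and K: "((\<lambda>t. bessel_K \<mu> t) \<longlongrightarrow> 0) at_top" for \<mu>
  proof -
    have b: "norm (t * bessel_K \<mu> t) \<le> t * exp (- t) * (exp 1 * bessel_K \<mu> 1)"
      "norm (bessel_K \<mu> t) \<le> t * exp (- t) * (exp 1 * bessel_K \<mu> 1)" if "t \<ge> 1" for t
    proof -
      have p: "0 \<le> bessel_K \<mu> t" using that by (intro bessel_K_nonneg) simp
      have "t * bessel_K \<mu> t \<le> t * (exp (1 - t) * bessel_K \<mu> 1)"
        using that bessel_K_exp_decay[OF that] by (intro mult_left_mono) simp_all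
      also have "\<dots> = t * exp (- t) * (exp 1 * bessel_K \<mu> 1)"
        by (simp add: exp_diff exp_minus field_simps)
      finally have 1: "t * bessel_K \<mu> t \<le> t * exp (- t) * (exp 1 * bessel_K \<mu> 1)" .
      moreover have "norm (t * bessel_K \<mu> t) = t * bessel_K \<mu> t" using that p by (simp add: abs_mult)
      ultimately show "norm (t * bessel_K \<mu> t) \<le> t * exp (- t) * (exp 1 * bessel_K \<mu> 1)"
        by linarith
      have "bessel_K \<mu> t \<le> t * bessel_K \<mu> t" using that p mult_right_mono[of 1 t] by simp
      moreover have "norm (bessel_K \<mu> t) = bessel_K \<mu> t" using p by simp
      ultimately show "norm (bessel_K \<mu> t) \<le> t * exp (- t) * (exp 1 * bessel_K \<mu> 1)"
        using 1 by linarith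
    qed
    have lim: "((\<lambda>t::real. t * exp (- t) * (exp 1 * bessel_K \<mu> 1)) \<longlongrightarrow> 0) at_top"
      using tendsto_power_div_exp_0[of 1] by (intro tendsto_mult_left_zero) (simp add: exp_minus divide_inverse)
    show "((\<lambda>t. t * bessel_K \<mu> t) \<longlongrightarrow> 0) at_top"
      by (rule Lim_null_comparison[OF eventually_at_top_linorderI[of 1] lim]) (rule b(1))
    show "((\<lambda>t. bessel_K \<mu> t) \<longlongrightarrow> 0) at_top"
      by (rule Lim_null_comparison[OF eventually_at_top_linorderI[of 1] lim]) (rule b(2))
  qed
  have "((\<lambda>t. (t * bessel_K (\<nu> - 1) t) * bessel_K (\<nu> - 1) t - (t * bessel_K \<nu> t) * bessel_K \<nu> t
      + (2 * \<nu> - 1) * bessel_K (\<nu> - 1) t * bessel_K \<nu> t) \<longlongrightarrow> 0 * 0 - 0 * 0 + (2 * \<nu> - 1) * 0 * 0) at_top"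
    by (intro tendsto_intros xK K)
  then have "(?f \<longlongrightarrow> 0) at_top" by (simp add: power2_eq_square algebra_simps)
  then have "0 \<le> ?f x"
    by (rule tendsto_upperbound) (use mono in \<open>auto intro: eventually_at_top_linorderI\<close>)
  then show ?thesis by (simp add: algebra_simps)
qed

section \<open>The explicit integral of I, and bounds on products of I and K\<close>

lemma set_integrable_exp_powr_bessel_I:
  assumes \<nu>: "\<nu> > -1/2" and \<alpha>: "\<alpha> > 0" and x: "x > 0"
  shows "set_integrable lborel {0<..<x} (\<lambda>t. exp (- \<alpha> * t) * t powr \<nu> * bessel_I \<nu> (\<alpha> * t))" (is ?A)
    and "(LBINT t:{0<..<x}. exp (- \<alpha> * t) * t powr \<nu> * bessel_I \<nu> (\<alpha> * t))
      = exp (- \<alpha> * x) * x powr (\<nu> + 1) * (bessel_I \<nu> (\<alpha> * x) + bessel_I (\<nu> + 1) (\<alpha> * x)) / (2 * \<nu> + 1)" (is ?B)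
proof -
  let ?f = "\<lambda>t. exp (- \<alpha> * t) * t powr \<nu> * bessel_I \<nu> (\<alpha> * t)"
  let ?F = "\<lambda>x. exp (- \<alpha> * x) * x powr (\<nu> + 1) * (bessel_I \<nu> (\<alpha> * x) + bessel_I (\<nu> + 1) (\<alpha> * x)) / (2 * \<nu> + 1)"
  have n: "\<nu> > -1" "\<nu> + 1 > -1" using \<nu> by simp_all
  \<comment> \<open>As in \<open>bessel_I_antimono_order\<close> with signs reversed: e^(-x)
    x^(nu+1) is the integrating factor for I_nu + I_{nu+1} and leaves (2 nu + 1)/x I_nu.\<close>
  have dF: "(?F has_real_derivative ?f t) (at t)" if t: "t > 0" for t
  proof -
    have at: "\<alpha> * t > 0" using t \<alpha> by simp
    define A B P where "A = bessel_I \<nu>" and "B = bessel_I (\<nu> + 1)" and "P = (\<lambda>x. x powr (\<nu> + 1))"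
    note d = bessel_I_deriv_up[OF n(1) at] bessel_I_deriv_down[OF n(1) at]
    note d' = d[folded A_def B_def]
    have dP: "(P has_real_derivative (\<nu> + 1) / t * P t) (at t)"
      unfolding P_def by (rule DERIV_powr_pos[OF t])
    have m: "((\<lambda>x. \<alpha> * x) has_real_derivative \<alpha>) (at t)" by (auto intro!: derivative_eq_intros)
    have "((\<lambda>x. exp (- \<alpha> * x) * P x * (A (\<alpha> * x) + B (\<alpha> * x))) has_real_derivative
        (2 * \<nu> + 1) * (exp (- \<alpha> * t) * (P t / t) * A (\<alpha> * t))) (at t)"
      using t \<alpha>
      by (auto intro!: derivative_eq_intros DERIV_chain2[OF d'(1) m] DERIV_chain2[OF d'(2) m] dP)
        (simp add: field_simps)
    from DERIV_cdivide[OF this, of "2 * \<nu> + 1"]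
    have "((\<lambda>x. exp (- \<alpha> * x) * P x * (A (\<alpha> * x) + B (\<alpha> * x)) / (2 * \<nu> + 1)) has_real_derivative
        exp (- \<alpha> * t) * (P t / t) * A (\<alpha> * t)) (at t)"
      using \<nu> by (elim DERIV_cong) simp
    moreover have "P t / t = t powr \<nu>" using t by (simp add: P_def powr_add)
    ultimately show ?thesis by (simp only: A_def B_def P_def)
  qed
  have cont: "isCont ?f t" if "ereal 0 < ereal t" for t
  proof -
    have "isCont (\<lambda>t. bessel_I \<nu> (\<alpha> * t)) t"
      using that \<alpha> by (intro isCont_o2[OF _ DERIV_isCont[OF bessel_I_deriv_up[OF n(1)]]]) auto
    then show ?thesis using that by (intro continuous_intros) auto
  qed
  have nonneg: "0 \<le> ?f t" if "ereal 0 < ereal t" for t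
    using that \<alpha> bessel_I_pos[OF n(1), of "\<alpha> * t"] by simp
  have scaled: "((\<lambda>x. x powr (\<nu> + 1) * bessel_I \<mu> (\<alpha> * x)) \<longlongrightarrow> 0) (at_right 0)" if "\<mu> > -1" "\<nu> + 1 + \<mu> > 0" for \<mu>
  proof -
    have "filterlim (\<lambda>x. \<alpha> * x) (at_right 0) (at_right 0)"
      unfolding filterlim_at using \<alpha> by (auto intro!: tendsto_eq_intros simp: eventually_at_filter)
    then have "((\<lambda>x. (\<alpha> * x) powr (\<nu> + 1) * bessel_I \<mu> (\<alpha> * x)) \<longlongrightarrow> 0) (at_right 0)"
      using filterlim_compose[OF tendsto_powr_bessel_I_0[OF that]] by blast
    then have "((\<lambda>x. \<alpha> powr (- (\<nu> + 1)) * ((\<alpha> * x) powr (\<nu> + 1) * bessel_I \<mu> (\<alpha> * x))) \<longlongrightarrow> 0) (at_right 0)"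
      by (rule tendsto_mult_right_zero)
    moreover have "\<alpha> powr (- (\<nu> + 1)) * ((\<alpha> * x) powr (\<nu> + 1) * bessel_I \<mu> (\<alpha> * x)) = x powr (\<nu> + 1) * bessel_I \<mu> (\<alpha> * x)"
      if "x > 0" for x
    proof -
      have "\<alpha> powr (- (\<nu> + 1)) * \<alpha> powr (\<nu> + 1) = 1"
        using \<alpha> by (simp flip: powr_add)
      moreover have "(\<alpha> * x) powr (\<nu> + 1) = \<alpha> powr (\<nu> + 1) * x powr (\<nu> + 1)"
        using that \<alpha> by (simp add: powr_mult)
      ultimately show ?thesis by (simp only: mult.assoc[symmetric] mult_1_left)
    qed
    ultimately show ?thesis
      by (elim Lim_transform_eventually) (auto simp: eventually_at_filter)
  qed
  have lim0: "(?F \<longlongrightarrow> 0) (at_right 0)"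
  proof -
    have "((\<lambda>x. exp (- \<alpha> * x) * (x powr (\<nu> + 1) * bessel_I \<nu> (\<alpha> * x) + x powr (\<nu> + 1) * bessel_I (\<nu> + 1) (\<alpha> * x)) / (2 * \<nu> + 1))
        \<longlongrightarrow> exp (- \<alpha> * 0) * (0 + 0) / (2 * \<nu> + 1)) (at_right 0)"
      using \<nu> by (intro tendsto_intros scaled) auto
    then show ?thesis by (simp add: algebra_simps)
  qed
  have limx: "(?F \<longlongrightarrow> ?F x) (at_left x)"
    using DERIV_isCont[OF dF[OF x]] by (simp add: isCont_def filterlim_at_split)
  \<comment> \<open>For nu < 0 the integrand behaves like t^(2 nu) at 0 and is unbounded. Being
    nonnegative, it gets its integrability together with its value from the limits of the
    antiderivative.\<close>
  have "set_integrable lborel (einterval (ereal 0) (ereal x)) ?f"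
    "(LBINT t=ereal 0..ereal x. ?f t) = ?F x - 0"
    by (rule interval_integral_FTC_nonneg[where F = ?F];
        use x dF cont nonneg lim0 limx in \<open>simp add: ereal_tendsto_simps\<close>)+
  then show ?A ?B using x by (simp_all add: interval_integral_Ioo)
qed

text \<open>The rearrangement (I+J)(K+L) = 2(IL + JK) - (I-J)(L-K) turns the monotonicity in the
  order into a sign, with the Wronskian in front. The first bound serves f', the second f.\<close>

lemma bessel_I_K_product_bound:
  assumes \<nu>: "\<nu> > -1/2" and x: "x > 0"
  shows "x * (bessel_I \<nu> x + bessel_I (\<nu> + 1) x) * (bessel_K \<nu> x + bessel_K (\<nu> + 1) x) \<le> 2"
    and "x * (bessel_I \<nu> x + bessel_I (\<nu> + 1) x) * bessel_K \<nu> x \<le> 1"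
proof -
  have n: "\<nu> > -1" using \<nu> by simp
  let ?I = "bessel_I \<nu> x" and ?J = "bessel_I (\<nu> + 1) x" and ?K = "bessel_K \<nu> x" and ?L = "bessel_K (\<nu> + 1) x"
  have JI: "?J \<le> ?I" by (rule bessel_I_antimono_order[OF \<nu> x])
  have KL: "?K \<le> ?L" using \<nu> x by (intro bessel_K_mono_order) auto
  have W: "x * (?I * ?L + ?J * ?K) \<le> 1" by (rule bessel_Wronskian_le_1[OF \<nu> x])
  have D: "0 \<le> x * ((?I - ?J) * (?L - ?K))" using JI KL x by simp
  have "x * (?I + ?J) * (?K + ?L) = 2 * (x * (?I * ?L + ?J * ?K)) - x * ((?I - ?J) * (?L - ?K))"
    by (simp add: algebra_simps)
  also have "\<dots> \<le> 2 * (x * (?I * ?L + ?J * ?K))"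
    by (simp only: diff_le_eq le_add_same_cancel1 D)
  also have "\<dots> \<le> 2" using mult_left_mono[OF W, of 2] by simp
  finally show "x * (?I + ?J) * (?K + ?L) \<le> 2" .
  have "x * (?I + ?J) * ?K = x * (?I * ?K + ?J * ?K)"
    by (simp add: algebra_simps)
  also have "\<dots> \<le> x * (?I * ?L + ?J * ?K)"
    using x KL bessel_I_pos[OF n x] by (intro mult_left_mono add_right_mono) auto
  finally show "x * (?I + ?J) * ?K \<le> 1" using W by (rule order_trans)
qed

text \<open>The right side is the limit of the left side as y tends to 0 with s fixed. With the
  derivative formulas that fit the two powers, the terms in nu cancel, and the sign of the
  derivative in y is that of I_{nu+1}(y) K_nu(y+s) - I_nu(y) K_{nu-1}(y+s).\<close>

lemma bessel_shift_bound:
  assumes \<nu>: "\<nu> > -1/2" and y: "y > 0" and s: "s > 0"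
  shows "y powr (- \<nu>) * bessel_I \<nu> y * ((y + s) powr \<nu> * bessel_K \<nu> (y + s))
    \<le> s powr \<nu> * bessel_K \<nu> s / (2 powr \<nu> * Gamma (\<nu> + 1))"
proof -
  have n: "\<nu> > -1" "\<nu> + 1 > -1" using \<nu> by simp_all
  let ?g = "\<lambda>y. y powr (- \<nu>) * bessel_I \<nu> y * ((y + s) powr \<nu> * bessel_K \<nu> (y + s))"
  let ?g' = "\<lambda>y. y powr (- \<nu>) * (y + s) powr \<nu> * (bessel_I (\<nu> + 1) y * bessel_K \<nu> (y + s) - bessel_I \<nu> y * bessel_K (\<nu> - 1) (y + s))"
  have dg: "(?g has_real_derivative ?g' y) (at y)" if y: "y > 0" for y
  proof -
    have ys: "y + s > 0" using y s by simp
    define A B P Q where "A = bessel_I \<nu>" and "B = bessel_K \<nu>" and "P = (\<lambda>x::real. x powr (- \<nu>))" and "Q = (\<lambda>x::real. x powr \<nu>)"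
    note d = bessel_I_deriv_up[OF n(1) y] bessel_K_deriv_down[OF ys, of \<nu>]
    note d' = d[folded A_def B_def]
    have dP: "(P has_real_derivative - \<nu> / y * P y) (at y)"
      unfolding P_def by (rule DERIV_powr_pos[OF y])
    have dQ: "(Q has_real_derivative \<nu> / (y + s) * Q (y + s)) (at (y + s))"
      unfolding Q_def by (rule DERIV_powr_pos[OF ys])
    have m: "((\<lambda>y. y + s) has_real_derivative 1) (at y)" by (auto intro!: derivative_eq_intros)
    have "((\<lambda>y. P y * A y * (Q (y + s) * B (y + s))) has_real_derivative
        P y * Q (y + s) * (bessel_I (\<nu> + 1) y * B (y + s) - A y * bessel_K (\<nu> - 1) (y + s))) (at y)"
      using y ys
      by (auto intro!: derivative_eq_intros DERIV_chain2[OF d'(2) m] DERIV_chain2[OF dQ m] dP d'(1))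
        (simp add: field_simps)
    then show ?thesis by (simp only: A_def B_def P_def Q_def)
  qed
  have neg: "?g' y \<le> 0" if y: "y > 0" for y
  proof -
    define z where "z = y + s"
    have z: "z > 0" "y \<le> z" using y s by (simp_all add: z_def)
    let ?I = "bessel_I \<nu> y" and ?J = "bessel_I (\<nu> + 1) y" and ?K = "bessel_K \<nu> z" and ?M = "bessel_K (\<nu> - 1) z"
    have pos: "?I > 0" "?J > 0" "0 \<le> ?K" "0 \<le> ?M"
      using bessel_I_pos[OF n(1) y] bessel_I_pos[OF n(2) y] bessel_K_nonneg[OF z(1)] by auto
    \<comment> \<open>Put p = \<open>?J\<close> / \<open>?I\<close> and q = \<open>?M\<close> /
      \<open>?K\<close>. For nu > 1/2 the two gap lemmas give p^2 + c p <= 1 <= q^2 + c q with a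
      common c >= 0, hence p <= q, since t^2 + c t increases for t >= 0. Below this is carried out
      without quotients.\<close>
    have "?J * ?K \<le> ?I * ?M"
    proof (cases "\<nu> \<le> 1/2")
      case True
      have "?K \<le> ?M" using True \<nu> z by (intro bessel_K_mono_order) auto
      then show ?thesis using pos bessel_I_antimono_order[OF \<nu> y] by (intro mult_mono) auto
    next
      case False
      show ?thesis
      proof (rule ccontr)
        assume "\<not> ?thesis"
        then have lt: "?I * ?M < ?J * ?K" by simp
        \<comment> \<open>K is so far known only to be nonnegative; its positivity here follows from
          the negated claim.\<close>
        then have Kp: "?K > 0" using pos by (metis less_eq_real_def mult_nonneg_nonneg mult_zero_right not_le)
        let ?c = "(2 * \<nu> - 1) / z"
        have c: "?c \<ge> 0" using False z by simp
        have GK: "?K\<^sup>2 \<le> ?M\<^sup>2 + ?c * (?M * ?K)"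
        proof -
          have "z * ?K\<^sup>2 \<le> z * (?M\<^sup>2 + ?c * (?M * ?K))"
          proof -
            have "z * (?M\<^sup>2 + ?c * (?M * ?K)) = z * ?M\<^sup>2 + (2 * \<nu> - 1) * ?M * ?K"
              using z by (simp add: field_simps)
            then show ?thesis using bessel_K_order_gap[of \<nu> z] False z by simp
          qed
          then show ?thesis using z by (simp only: mult_le_cancel_left_pos)
        qed
        have GI: "?J\<^sup>2 + ?c * (?I * ?J) \<le> ?I\<^sup>2"
        proof -
          \<comment> \<open>The gap for I at y comes with (2 nu + 1)/y, the gap for K at z with (2
            nu - 1)/z. Since y <= z, the latter is smaller and can be used in both.\<close>
          have "?c \<le> (2 * \<nu> + 1) / y"
            using y z False by (intro frac_le) auto
          then have "?c * (?I * ?J) \<le> (2 * \<nu> + 1) / y * (?I * ?J)"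
            using pos by (intro mult_right_mono) auto
          moreover have "y * ((2 * \<nu> + 1) / y * (?I * ?J)) \<le> y * (?I\<^sup>2 - ?J\<^sup>2)"
            using bessel_I_order_gap[OF \<nu> y] y by (simp add: mult_ac)
          then have "(2 * \<nu> + 1) / y * (?I * ?J) \<le> ?I\<^sup>2 - ?J\<^sup>2"
            using y by (simp only: mult_le_cancel_left_pos)
          ultimately show ?thesis by linarith
        qed
        have "(?I * ?K)\<^sup>2 = ?I\<^sup>2 * ?K\<^sup>2" by (simp add: power_mult_distrib)
        also have "\<dots> \<le> ?I\<^sup>2 * (?M\<^sup>2 + ?c * (?M * ?K))"
          by (intro mult_left_mono GK) simp
        also have "\<dots> = (?I * ?M)\<^sup>2 + ?c * (?I * ?K) * (?I * ?M)"
          by (simp add: power2_eq_square algebra_simps)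
        also have "\<dots> < (?J * ?K)\<^sup>2 + ?c * (?I * ?K) * (?J * ?K)"
          using lt pos c mult_nonneg_nonneg[OF c mult_nonneg_nonneg[of ?I ?K]] by (intro add_less_le_mono power_strict_mono mult_left_mono) auto
        also have "\<dots> = ?K\<^sup>2 * (?J\<^sup>2 + ?c * (?I * ?J))"
          by (simp add: power2_eq_square algebra_simps)
        also have "\<dots> \<le> ?K\<^sup>2 * ?I\<^sup>2"
          by (intro mult_left_mono GI) simp
        finally show False by (simp add: power_mult_distrib mult.commute)
      qed
    qed
    then show ?thesis by (simp add: z_def mult_nonneg_nonpos)
  qed
  have mono: "?g y \<le> ?g u" if "0 < u" "u < y" for u
  proof (rule DERIV_nonpos_imp_nonincreasing[of u y ?g])
    fix t assume "u \<le> t"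
    then have "t > 0" using that by simp
    then show "\<exists>d. (?g has_real_derivative d) (at t) \<and> d \<le> 0" using dg neg by blast
  qed (use that in simp)
  have "isCont (bessel_K \<nu>) s" by (rule DERIV_isCont[OF bessel_K_deriv[OF s]])
  then have "((\<lambda>u. bessel_K \<nu> (u + s)) \<longlongrightarrow> bessel_K \<nu> s) (at_right 0)"
    by (rule isCont_tendsto_compose) (auto intro!: tendsto_eq_intros)
  then have "(?g \<longlongrightarrow> 1 / (2 powr \<nu> * Gamma (\<nu> + 1)) * ((0 + s) powr \<nu> * bessel_K \<nu> s)) (at_right 0)"
    using s by (intro tendsto_intros tendsto_bessel_I_0 n) auto
  then have "?g y \<le> 1 / (2 powr \<nu> * Gamma (\<nu> + 1)) * ((0 + s) powr \<nu> * bessel_K \<nu> s)"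
  proof (rule tendsto_lowerbound)
    show "\<forall>\<^sub>F u in at_right 0. ?g y \<le> ?g u"
      unfolding eventually_at_right_field using mono y by blast
  qed simp
  then show ?thesis by simp
qed

section \<open>The solution on a half-line\<close>

lemma set_integral_mult_bounded:
  fixes w g :: "real \<Rightarrow> real"
  assumes w: "set_integrable lborel A w" and g: "g \<in> borel_measurable borel" and b: "\<And>x. \<bar>g x\<bar> \<le> G"
  shows "set_integrable lborel A (\<lambda>t. w t * g t)"
    and "\<bar>LBINT t:A. w t * g t\<bar> \<le> G * (LBINT t:A. \<bar>w t\<bar>)"
proof -
  have G: "0 \<le> G" using b[of 0] by linarith
  have w': "integrable lborel (\<lambda>t. indicator A t * w t)"
    using w by (simp add: set_integrable_def)
  have wa: "set_integrable lborel A (\<lambda>t. \<bar>w t\<bar>)"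
    by (rule set_integrable_abs[OF w])
  show i: "set_integrable lborel A (\<lambda>t. w t * g t)"
    unfolding set_integrable_def
  proof (rule Bochner_Integration.integrable_bound)
    show "integrable lborel (\<lambda>t. G * (indicator A t * w t))" using w' by simp
    have "(\<lambda>t. (indicator A t * w t) * g t) \<in> borel_measurable lborel"
      using borel_measurable_integrable[OF w'] g by simp
    then show "(\<lambda>t. indicator A t *\<^sub>R (w t * g t)) \<in> borel_measurable lborel"
      by (simp add: mult.assoc)
    show "AE t in lborel. norm (indicator A t *\<^sub>R (w t * g t)) \<le> norm (G * (indicator A t * w t))"
      using b G by (auto intro!: AE_I2 mult_right_mono simp: abs_mult indicator_def mult.commute)
  qed
  have "\<bar>LBINT t:A. w t * g t\<bar> \<le> (LBINT t:A. \<bar>w t * g t\<bar>)"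
    using set_integral_norm_bound[OF i] by simp
  also have "\<dots> \<le> (LBINT t:A. G * \<bar>w t\<bar>)"
    using set_integrable_abs[OF i] wa b
    by (intro set_integral_mono set_integrable_mult_right) (auto simp: abs_mult mult.commute mult_right_mono)
  finally show "\<bar>LBINT t:A. w t * g t\<bar> \<le> G * (LBINT t:A. \<bar>w t\<bar>)" by simp
qed

lemma interval_integral_abs_bound:
  fixes f :: "real \<Rightarrow> real"
  assumes i: "set_integrable lborel {min x y<..<max x y} f"
    and b: "\<And>t. min x y < t \<Longrightarrow> t < max x y \<Longrightarrow> \<bar>f t\<bar> \<le> B"
  shows "\<bar>LBINT t=x..y. f t\<bar> \<le> B * \<bar>y - x\<bar>"
proof -
  have c: "set_integrable lborel {min x y<..<max x y} (\<lambda>t. B)"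
    by (simp add: set_integrable_def emeasure_lborel_Ioo)
  have "\<bar>LBINT t:{min x y<..<max x y}. f t\<bar> \<le> (LBINT t:{min x y<..<max x y}. \<bar>f t\<bar>)"
    using set_integral_norm_bound[OF i] by simp
  also have "\<dots> \<le> (LBINT t:{min x y<..<max x y}. B)"
    using b by (intro set_integral_mono set_integrable_abs i c) auto
  also have "\<dots> = B * \<bar>y - x\<bar>"
    by (cases "x \<le> y") (auto simp: set_lebesgue_integral_def min_def max_def mult.commute)
  also have "\<bar>LBINT t:{min x y<..<max x y}. f t\<bar> = \<bar>LBINT t=x..y. f t\<bar>"
    by (cases "x \<le> y") (auto simp: interval_lebesgue_integral_def min_def max_def)
  finally show ?thesis .
qed

lemma tendsto_bessel_I_K_0:
  assumes \<nu>: "\<nu> > -1/2"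
  shows "((\<lambda>x. x * bessel_I \<nu> x * bessel_K \<nu> x) \<longlongrightarrow> 0) (at_right 0)"
proof -
  \<comment> \<open>The midpoint of |nu| and nu + 1, a nonempty range since nu > -1/2. Then K_nu <=
    K_mu is at most a multiple of x^(-mu), even for nu = 0 where K_nu is logarithmic, and x I_nu of
    size x^(nu+1) outweighs it.\<close>
  define \<mu> where "\<mu> = (\<bar>\<nu>\<bar> + 1 + \<nu>) / 2"
  have \<mu>: "\<mu> > 0" "\<bar>\<nu>\<bar> \<le> \<bar>\<mu>\<bar>" "1 - \<mu> + \<nu> > 0"
    unfolding \<mu>_def using \<nu> by (cases "\<nu> \<ge> 0"; simp add: field_simps)+
  let ?C = "2 powr (\<mu> - 1) * Gamma \<mu>"
  have n: "\<nu> > -1" using \<nu> by simp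
  have bound: "norm (x * bessel_I \<nu> x * bessel_K \<nu> x) \<le> x powr (1 - \<mu>) * bessel_I \<nu> x * ?C" if x: "x > 0" for x
  proof -
    have I: "bessel_I \<nu> x > 0" by (rule bessel_I_pos[OF n x])
    have "x powr \<mu> * bessel_K \<nu> x \<le> x powr \<mu> * bessel_K \<mu> x"
      by (intro mult_left_mono bessel_K_mono_order x \<mu>) simp
    also have "\<dots> \<le> ?C" by (rule bessel_K_le_Gamma[OF x \<mu>(1)])
    finally have "x powr (1 - \<mu>) * bessel_I \<nu> x * (x powr \<mu> * bessel_K \<nu> x) \<le> x powr (1 - \<mu>) * bessel_I \<nu> x * ?C"
      using I by (intro mult_left_mono) auto
    moreover have "x powr (1 - \<mu>) * bessel_I \<nu> x * (x powr \<mu> * bessel_K \<nu> x) = x * bessel_I \<nu> x * bessel_K \<nu> x"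
      using x by (simp add: powr_diff field_simps)
    moreover have "norm (x * bessel_I \<nu> x * bessel_K \<nu> x) = x * bessel_I \<nu> x * bessel_K \<nu> x"
      using x I bessel_K_nonneg[OF x, of \<nu>] by simp
    ultimately show ?thesis by simp
  qed
  show ?thesis
  proof (rule Lim_null_comparison)
    show "\<forall>\<^sub>F x in at_right 0. norm (x * bessel_I \<nu> x * bessel_K \<nu> x) \<le> x powr (1 - \<mu>) * bessel_I \<nu> x * ?C"
      unfolding eventually_at_right_field using bound by (intro exI[of _ 1]) auto
    show "((\<lambda>x. x powr (1 - \<mu>) * bessel_I \<nu> x * ?C) \<longlongrightarrow> 0) (at_right 0)"
      by (intro tendsto_mult_left_zero tendsto_powr_bessel_I_0 n \<mu>(3))
  qed
qed

lemma filterlim_mult_at_right_0: "c > (0::real) \<Longrightarrow> filterlim (\<lambda>x. c * x) (at_right 0) (at_right 0)"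
  unfolding filterlim_at by (auto intro!: tendsto_eq_intros simp: eventually_at_filter)

text \<open>The sign of beta is free and \<open>g\<close> need not have mean zero, so the same
  estimates serve x > 0 with (beta, g) and x < 0 with (-beta, g reflected). Integrability of the
  K-weight is an assumption because it will be read off from the density of Z.\<close>

locale vg_half_line =
  fixes \<nu> \<alpha> \<beta> G :: real and g :: "real \<Rightarrow> real"
  assumes \<nu>: "\<nu> > -1/2" and \<alpha>: "\<alpha> > 0" and \<beta>: "\<bar>\<beta>\<bar> < \<alpha>"
    and g_measurable: "g \<in> borel_measurable borel" and g_bound: "\<And>x. \<bar>g x\<bar> \<le> G"
    and integrable_K: "set_integrable lborel {0<..} (\<lambda>t. exp (\<beta> * t) * t powr \<nu> * bessel_K \<nu> (\<alpha> * t))"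
begin

definition "wI t = exp (\<beta> * t) * t powr \<nu> * bessel_I \<nu> (\<alpha> * t)"
definition "wK t = exp (\<beta> * t) * t powr \<nu> * bessel_K \<nu> (\<alpha> * t)"
definition "U x = exp (- \<beta> * x) * x powr (- \<nu>) * bessel_K \<nu> (\<alpha> * x)"
definition "V x = exp (- \<beta> * x) * x powr (- \<nu>) * bessel_I \<nu> (\<alpha> * x)"
text \<open>The derivative of \<open>U\<close>: the terms nu/x from the power and from K_nu cancel,
  so no coefficient is singular at 0. The same holds for \<open>V'\<close>.\<close>

definition "U' x = - (exp (- \<beta> * x) * x powr (- \<nu>) * (\<beta> * bessel_K \<nu> (\<alpha> * x) + \<alpha> * bessel_K (\<nu> + 1) (\<alpha> * x)))"
definition "V' x = exp (- \<beta> * x) * x powr (- \<nu>) * (\<alpha> * bessel_I (\<nu> + 1) (\<alpha> * x) - \<beta> * bessel_I \<nu> (\<alpha> * x))"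
definition "P x = (LBINT t:{0<..<x}. wI t * g t)"
definition "R x = (LBINT t:{x<..}. wK t * g t)"
definition "F x = U x * P x + V x * R x"
definition "F' x = U' x * P x + V' x * R x"
definition "J = (LBINT t:{0<..}. wK t)"
text \<open>The limit of \<open>V\<close> at 0 from the right.\<close>

definition "c = \<alpha> powr \<nu> / (2 powr \<nu> * Gamma (\<nu> + 1))"

section \<open>Bounds on F and F' on the half-line\<close>

lemma \<nu>1: "\<nu> > -1" "\<nu> + 1 > -1"
  using \<nu> by simp_all

lemma c_nonneg: "0 \<le> c"
proof -
  have "0 < Gamma (\<nu> + 1)" using \<nu>1 by (intro Gamma_real_pos) simp
  then show ?thesis by (simp add: c_def)
qed

lemma G_nonneg: "0 \<le> G"
  using g_bound[of 0] by linarith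

lemma bessel_I_scaled_pos: "x > 0 \<Longrightarrow> bessel_I \<nu> (\<alpha> * x) > 0" "x > 0 \<Longrightarrow> bessel_I (\<nu> + 1) (\<alpha> * x) > 0"
  using \<alpha> by (auto intro!: bessel_I_pos \<nu>1)

lemma bessel_K_scaled_nonneg: "x > 0 \<Longrightarrow> 0 \<le> bessel_K \<mu> (\<alpha> * x)"
  using \<alpha> by (intro bessel_K_nonneg) simp

lemma wI_nonneg: "t > 0 \<Longrightarrow> 0 \<le> wI t"
  using bessel_I_scaled_pos by (simp add: wI_def less_imp_le)

lemma wK_nonneg: "t > 0 \<Longrightarrow> 0 \<le> wK t"
  using bessel_K_scaled_nonneg by (simp add: wK_def)

lemma integrable_wK: "set_integrable lborel {0<..} wK"
  unfolding wK_def[abs_def] by (rule integrable_K)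

text \<open>Write exp(beta t) = exp(-alpha t) exp((alpha + beta) t). The second factor is
  nondecreasing and so at most its value at x; the integral of the rest is explicit. Dividing by
  exp(beta x) shows why beta = -alpha is the extreme case.\<close>

lemma integrable_wI:
  assumes x: "x > 0"
  shows "set_integrable lborel {0<..<x} wI"
    and "(LBINT t:{0<..<x}. wI t)
      \<le> exp (\<beta> * x) * x powr (\<nu> + 1) * (bessel_I \<nu> (\<alpha> * x) + bessel_I (\<nu> + 1) (\<alpha> * x)) / (2 * \<nu> + 1)"
proof -
  let ?w = "\<lambda>t. exp (- \<alpha> * t) * t powr \<nu> * bessel_I \<nu> (\<alpha> * t)"
  \<comment> \<open>\<open>min t x\<close> changes nothing on the interval and makes the factor
    bounded on the whole line, as \<open>set_integral_mult_bounded\<close> requires.\<close>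
  let ?e = "\<lambda>t. exp ((\<alpha> + \<beta>) * min t x)"
  have ab: "0 \<le> \<alpha> + \<beta>" using \<beta> by (simp add: abs_less_iff)
  note w = set_integrable_exp_powr_bessel_I[OF \<nu> \<alpha> x]
  have e: "?e \<in> borel_measurable borel" by measurable
  have b: "\<bar>?e t\<bar> \<le> exp ((\<alpha> + \<beta>) * x)" for t using ab by (simp add: mult_left_mono)
  have eq: "?w t * ?e t = wI t" if "t \<in> {0<..<x}" for t
  proof -
    have "exp (- \<alpha> * t) * ?e t = exp (\<beta> * t)"
      using that by (simp add: min_def algebra_simps flip: exp_add)
    then show ?thesis by (simp add: wI_def mult_ac)
  qed
  have "set_integrable lborel {0<..<x} (\<lambda>t. ?w t * ?e t)"
    by (rule set_integral_mult_bounded(1)[OF w(1) e b])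
  also have "?this \<longleftrightarrow> set_integrable lborel {0<..<x} wI"
    by (rule set_integrable_cong) (use eq in auto)
  finally show "set_integrable lborel {0<..<x} wI" .
  have "(LBINT t:{0<..<x}. wI t) = (LBINT t:{0<..<x}. ?w t * ?e t)"
    by (rule set_lebesgue_integral_cong) (use eq in auto)
  also have "\<dots> \<le> \<bar>LBINT t:{0<..<x}. ?w t * ?e t\<bar>" by simp
  also have "\<dots> \<le> exp ((\<alpha> + \<beta>) * x) * (LBINT t:{0<..<x}. \<bar>?w t\<bar>)"
    by (rule set_integral_mult_bounded(2)[OF w(1) e b])
  also have "(LBINT t:{0<..<x}. \<bar>?w t\<bar>) = (LBINT t:{0<..<x}. ?w t)"
    by (rule set_lebesgue_integral_cong) (use bessel_I_scaled_pos in \<open>auto simp: abs_mult less_imp_le\<close>)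
  also have "\<dots> = exp (- \<alpha> * x) * x powr (\<nu> + 1) * (bessel_I \<nu> (\<alpha> * x) + bessel_I (\<nu> + 1) (\<alpha> * x)) / (2 * \<nu> + 1)"
    by (rule w(2))
  also have "exp ((\<alpha> + \<beta>) * x) * \<dots>
      = (exp ((\<alpha> + \<beta>) * x) * exp (- \<alpha> * x)) * x powr (\<nu> + 1) * (bessel_I \<nu> (\<alpha> * x) + bessel_I (\<nu> + 1) (\<alpha> * x)) / (2 * \<nu> + 1)"
    by simp
  also have "exp ((\<alpha> + \<beta>) * x) * exp (- \<alpha> * x) = exp (\<beta> * x)"
    by (simp add: algebra_simps flip: exp_add)
  finally show "(LBINT t:{0<..<x}. wI t)
      \<le> exp (\<beta> * x) * x powr (\<nu> + 1) * (bessel_I \<nu> (\<alpha> * x) + bessel_I (\<nu> + 1) (\<alpha> * x)) / (2 * \<nu> + 1)" .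
qed

lemma P_bound:
  assumes x: "x > 0"
  shows "\<bar>P x\<bar> \<le> G * (exp (\<beta> * x) * x powr (\<nu> + 1) * (bessel_I \<nu> (\<alpha> * x) + bessel_I (\<nu> + 1) (\<alpha> * x)) / (2 * \<nu> + 1))"
proof -
  have "(LBINT t:{0<..<x}. \<bar>wI t\<bar>) = (LBINT t:{0<..<x}. wI t)"
    by (rule set_lebesgue_integral_cong) (use wI_nonneg in auto)
  then have "\<bar>P x\<bar> \<le> G * (LBINT t:{0<..<x}. wI t)"
    using set_integral_mult_bounded(2)[OF integrable_wI(1)[OF x] g_measurable g_bound] by (simp add: P_def)
  then show ?thesis
    using mult_left_mono[OF integrable_wI(2)[OF x] G_nonneg] by (rule order_trans)
qed

lemma R_bound:
  assumes x: "x > 0"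
  shows "\<bar>R x\<bar> \<le> G * (LBINT t:{x<..}. wK t)"
proof -
  have i: "set_integrable lborel {x<..} wK"
    by (rule set_integrable_subset[OF integrable_wK]) (use x in auto)
  have "(LBINT t:{x<..}. \<bar>wK t\<bar>) = (LBINT t:{x<..}. wK t)"
    by (rule set_lebesgue_integral_cong) (use wK_nonneg x in auto)
  then show ?thesis
    using set_integral_mult_bounded(2)[OF i g_measurable g_bound] unfolding R_def by simp
qed

lemma exp_powr_cancel:
  assumes "x > 0"
  shows "exp (- \<beta> * x) * x powr (- \<nu>) * (exp (\<beta> * x) * x powr (\<nu> + 1)) = x"
proof -
  have "exp (- \<beta> * x) * exp (\<beta> * x) = 1" by (simp flip: exp_add)
  moreover have "x powr (- \<nu>) * x powr (\<nu> + 1) = x" using assms by (simp flip: powr_add)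
  moreover have "exp (- \<beta> * x) * x powr (- \<nu>) * (exp (\<beta> * x) * x powr (\<nu> + 1))
      = (exp (- \<beta> * x) * exp (\<beta> * x)) * (x powr (- \<nu>) * x powr (\<nu> + 1))"
    by (simp only: mult_ac)
  ultimately show ?thesis by (simp only: mult_1_left)
qed

text \<open>Kept in product form: \<open>U_P_bound\<close> needs only that the product is bounded,
  whereas \<open>F_tendsto_0\<close> needs that it vanishes at 0.\<close>

lemma U_P_bound_product:
  assumes x: "x > 0"
  shows "\<bar>U x * P x\<bar> \<le> G * (x * (bessel_I \<nu> (\<alpha> * x) + bessel_I (\<nu> + 1) (\<alpha> * x)) * bessel_K \<nu> (\<alpha> * x)) / (2 * \<nu> + 1)"
proof -
  let ?S = "bessel_I \<nu> (\<alpha> * x) + bessel_I (\<nu> + 1) (\<alpha> * x)"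
  have U: "0 \<le> U x" using x bessel_K_scaled_nonneg by (simp add: U_def)
  have "\<bar>U x * P x\<bar> = U x * \<bar>P x\<bar>" using U by (simp add: abs_mult)
  also have "\<dots> \<le> U x * (G * (exp (\<beta> * x) * x powr (\<nu> + 1) * ?S / (2 * \<nu> + 1)))"
    by (rule mult_left_mono[OF P_bound[OF x] U])
  also have "\<dots> = G * ((exp (- \<beta> * x) * x powr (- \<nu>) * (exp (\<beta> * x) * x powr (\<nu> + 1))) * ?S * bessel_K \<nu> (\<alpha> * x)) / (2 * \<nu> + 1)"
    unfolding U_def by simp
  finally show ?thesis unfolding exp_powr_cancel[OF x] .
qed

lemma U_P_bound:
  assumes x: "x > 0"
  shows "\<bar>U x * P x\<bar> \<le> G / (\<alpha> * (2 * \<nu> + 1))"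
proof -
  have "\<alpha> * x * (bessel_I \<nu> (\<alpha> * x) + bessel_I (\<nu> + 1) (\<alpha> * x)) * bessel_K \<nu> (\<alpha> * x) \<le> 1"
    using x \<alpha> by (intro bessel_I_K_product_bound \<nu>) simp
  then have "x * (bessel_I \<nu> (\<alpha> * x) + bessel_I (\<nu> + 1) (\<alpha> * x)) * bessel_K \<nu> (\<alpha> * x) \<le> 1 / \<alpha>"
    using \<alpha> by (simp add: field_simps)
  then have "G * (x * (bessel_I \<nu> (\<alpha> * x) + bessel_I (\<nu> + 1) (\<alpha> * x)) * bessel_K \<nu> (\<alpha> * x)) / (2 * \<nu> + 1)
      \<le> G * (1 / \<alpha>) / (2 * \<nu> + 1)"
    using \<nu> by (intro divide_right_mono mult_left_mono G_nonneg) auto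
  then show ?thesis using U_P_bound_product[OF x] by simp
qed

text \<open>|beta| < alpha bounds U' by a multiple of K_nu + K_{nu+1}. The product of both sums is
  at most 2, which is the numerator of 2/r.\<close>

lemma U'_P_bound:
  assumes x: "x > 0"
  shows "\<bar>U' x * P x\<bar> \<le> G * 2 / (2 * \<nu> + 1)"
proof -
  let ?S = "bessel_I \<nu> (\<alpha> * x) + bessel_I (\<nu> + 1) (\<alpha> * x)"
  let ?e = "exp (- \<beta> * x) * x powr (- \<nu>)"
  let ?L = "bessel_K \<nu> (\<alpha> * x) + bessel_K (\<nu> + 1) (\<alpha> * x)"
  have K: "0 \<le> bessel_K \<nu> (\<alpha> * x)" "0 \<le> bessel_K (\<nu> + 1) (\<alpha> * x)"
    using bessel_K_scaled_nonneg[OF x] by auto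
  have "\<bar>\<beta> * bessel_K \<nu> (\<alpha> * x) + \<alpha> * bessel_K (\<nu> + 1) (\<alpha> * x)\<bar> \<le> \<bar>\<beta>\<bar> * bessel_K \<nu> (\<alpha> * x) + \<alpha> * bessel_K (\<nu> + 1) (\<alpha> * x)"
    using K \<alpha> by (intro order_trans[OF abs_triangle_ineq]) (simp add: abs_mult)
  also have "\<dots> \<le> \<alpha> * bessel_K \<nu> (\<alpha> * x) + \<alpha> * bessel_K (\<nu> + 1) (\<alpha> * x)"
    using K \<beta> by (intro add_right_mono mult_right_mono) auto
  also have "\<dots> = \<alpha> * ?L" by (simp add: algebra_simps)
  finally have "\<bar>U' x\<bar> \<le> ?e * (\<alpha> * ?L)"
    unfolding U'_def abs_minus_cancel abs_mult[of "exp _ * _"] using x by (simp add: abs_mult)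
  then have "\<bar>U' x * P x\<bar> \<le> ?e * (\<alpha> * ?L) * (G * (exp (\<beta> * x) * x powr (\<nu> + 1) * ?S / (2 * \<nu> + 1)))"
    unfolding abs_mult using P_bound[OF x] K \<alpha> by (intro mult_mono) auto
  also have "\<dots> = G * (\<alpha> * (?e * (exp (\<beta> * x) * x powr (\<nu> + 1))) * ?S * ?L) / (2 * \<nu> + 1)"
    by simp
  also have "\<dots> = G * (\<alpha> * x * ?S * ?L) / (2 * \<nu> + 1)"
    unfolding exp_powr_cancel[OF x] ..
  also have "\<dots> \<le> G * 2 / (2 * \<nu> + 1)"
    using x \<alpha> \<nu> by (intro divide_right_mono mult_left_mono bessel_I_K_product_bound G_nonneg) auto
  finally show ?thesis .
qed

text \<open>After the shift t = x + s the exponentials combine to exp(beta s), and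
  \<open>bessel_shift_bound\<close> applies to each s separately.\<close>

lemma V_tail_bound:
  assumes x: "x > 0"
  shows "V x * (LBINT t:{x<..}. wK t) \<le> c * J"
proof -
  have i: "set_integrable lborel {x<..} wK"
    by (rule set_integrable_subset[OF integrable_wK]) (use x in auto)
  have shift: "indicator {x<..} (x + 1 * s) = (indicator {0<..} s :: real)" for s
    by (simp add: indicator_def)
  have "integrable lborel (\<lambda>s. indicator {x<..} (x + 1 * s) *\<^sub>R wK (x + 1 * s))"
    using i unfolding set_integrable_def by (rule lborel_integrable_real_affine) simp
  then have i': "set_integrable lborel {0<..} (\<lambda>s. wK (x + s))"
    unfolding shift set_integrable_def by simp
  have "(LBINT t:{x<..}. wK t) = (LBINT s:{0<..}. wK (x + s))"
    unfolding set_lebesgue_integral_def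
    using lborel_integral_real_affine[of 1 "\<lambda>t. indicator {x<..} t *\<^sub>R wK t" x]
    unfolding shift by simp
  then have "V x * (LBINT t:{x<..}. wK t) = (LBINT s:{0<..}. V x * wK (x + s))" by simp
  also have "\<dots> \<le> (LBINT s:{0<..}. c * wK s)"
  proof (rule set_integral_mono)
    fix s :: real assume "s \<in> {0<..}"
    then have s: "s > 0" by simp
    have a: "\<alpha> * x > 0" "\<alpha> * s > 0" using \<alpha> x s by auto
    have "(\<alpha> * x) powr (- \<nu>) * bessel_I \<nu> (\<alpha> * x) * ((\<alpha> * x + \<alpha> * s) powr \<nu> * bessel_K \<nu> (\<alpha> * x + \<alpha> * s))
        \<le> (\<alpha> * s) powr \<nu> * bessel_K \<nu> (\<alpha> * s) / (2 powr \<nu> * Gamma (\<nu> + 1))"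
      by (rule bessel_shift_bound[OF \<nu> a])
    moreover have "(\<alpha> * x) powr (- \<nu>) * bessel_I \<nu> (\<alpha> * x) * ((\<alpha> * x + \<alpha> * s) powr \<nu> * bessel_K \<nu> (\<alpha> * x + \<alpha> * s))
        = x powr (- \<nu>) * bessel_I \<nu> (\<alpha> * x) * ((x + s) powr \<nu> * bessel_K \<nu> (\<alpha> * (x + s)))"
    proof -
      have "\<alpha> * x + \<alpha> * s = \<alpha> * (x + s)" by (simp add: algebra_simps)
      moreover have "(\<alpha> * x) powr (- \<nu>) = \<alpha> powr (- \<nu>) * x powr (- \<nu>)" "(\<alpha> * (x + s)) powr \<nu> = \<alpha> powr \<nu> * (x + s) powr \<nu>"
        using \<alpha> x s by (simp_all add: powr_mult)
      moreover have "\<alpha> powr (- \<nu>) * \<alpha> powr \<nu> = 1" using \<alpha> by (simp flip: powr_add)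
      ultimately show ?thesis by (simp add: mult_ac)
    qed
    moreover have "(\<alpha> * s) powr \<nu> * bessel_K \<nu> (\<alpha> * s) / (2 powr \<nu> * Gamma (\<nu> + 1)) = c * (s powr \<nu> * bessel_K \<nu> (\<alpha> * s))"
      using \<alpha> s by (simp add: powr_mult c_def)
    ultimately have "x powr (- \<nu>) * bessel_I \<nu> (\<alpha> * x) * ((x + s) powr \<nu> * bessel_K \<nu> (\<alpha> * (x + s)))
        \<le> c * (s powr \<nu> * bessel_K \<nu> (\<alpha> * s))" by simp
    then have "exp (\<beta> * s) * (x powr (- \<nu>) * bessel_I \<nu> (\<alpha> * x) * ((x + s) powr \<nu> * bessel_K \<nu> (\<alpha> * (x + s))))
        \<le> exp (\<beta> * s) * (c * (s powr \<nu> * bessel_K \<nu> (\<alpha> * s)))" by (rule mult_left_mono) simp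
    moreover have "exp (- \<beta> * x) * exp (\<beta> * (x + s)) = exp (\<beta> * s)" by (simp add: algebra_simps flip: exp_add)
    then have "V x * wK (x + s) = exp (\<beta> * s) * (x powr (- \<nu>) * bessel_I \<nu> (\<alpha> * x) * ((x + s) powr \<nu> * bessel_K \<nu> (\<alpha> * (x + s))))"
    proof -
      have "V x * wK (x + s) = (exp (- \<beta> * x) * exp (\<beta> * (x + s)))
          * (x powr (- \<nu>) * bessel_I \<nu> (\<alpha> * x) * ((x + s) powr \<nu> * bessel_K \<nu> (\<alpha> * (x + s))))"
        by (simp only: V_def wK_def mult_ac)
      then show ?thesis using \<open>exp (- \<beta> * x) * exp (\<beta> * (x + s)) = exp (\<beta> * s)\<close> by (simp only:)
    qed
    moreover have "c * wK s = exp (\<beta> * s) * (c * (s powr \<nu> * bessel_K \<nu> (\<alpha> * s)))"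
      by (simp only: wK_def mult_ac)
    ultimately show "V x * wK (x + s) \<le> c * wK s" by (simp only:)
  qed (intro set_integrable_mult_right i' integrable_wK)+
  finally show ?thesis by (simp add: J_def)
qed

lemma V_nonneg: "x > 0 \<Longrightarrow> 0 \<le> V x"
  using bessel_I_scaled_pos by (simp add: V_def less_imp_le)

lemma V_R_bound:
  assumes x: "x > 0"
  shows "V x * \<bar>R x\<bar> \<le> G * (c * J)"
proof -
  have "V x * \<bar>R x\<bar> \<le> V x * (G * (LBINT t:{x<..}. wK t))"
    by (rule mult_left_mono[OF R_bound[OF x] V_nonneg[OF x]])
  also have "\<dots> = G * (V x * (LBINT t:{x<..}. wK t))" by simp
  also have "\<dots> \<le> G * (c * J)" by (rule mult_left_mono[OF V_tail_bound[OF x] G_nonneg])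
  finally show ?thesis .
qed

text \<open>Both alpha I_{nu+1} and |beta| I_nu lie between 0 and alpha I_nu. They are subtracted
  for beta >= 0 and added for beta < 0, hence the factor 2, for which \<open>J_weighted_le\<close>
  compensates.\<close>

lemma V'_bound:
  assumes x: "x > 0"
  shows "\<bar>V' x\<bar> \<le> (if \<beta> \<ge> 0 then 1 else 2) * \<alpha> * V x"
proof -
  let ?I = "bessel_I \<nu> (\<alpha> * x)" and ?J = "bessel_I (\<nu> + 1) (\<alpha> * x)"
  have ax: "\<alpha> * x > 0" using \<alpha> x by simp
  have pos: "0 < ?I" "0 < ?J" using bessel_I_scaled_pos[OF x] by auto
  have JI: "\<alpha> * ?J \<le> \<alpha> * ?I" using \<alpha> by (intro mult_left_mono bessel_I_antimono_order \<nu> ax) auto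
  have bI: "\<bar>\<beta>\<bar> * ?I \<le> \<alpha> * ?I" using \<beta> pos by (intro mult_right_mono) auto
  have aJ: "0 \<le> \<alpha> * ?J" using \<alpha> pos by simp
  have b0: "0 \<le> \<bar>\<beta>\<bar> * ?I" using pos by simp
  have "\<bar>\<alpha> * ?J - \<beta> * ?I\<bar> \<le> (if \<beta> \<ge> 0 then 1 else 2) * (\<alpha> * ?I)"
  proof (cases "\<beta> \<ge> 0")
    case True
    then have "\<bar>\<beta>\<bar> * ?I = \<beta> * ?I" by simp
    then show ?thesis using True JI bI aJ b0 unfolding abs_le_iff by simp
  next
    case False
    then have "\<bar>\<beta>\<bar> * ?I = - (\<beta> * ?I)" by simp
    then show ?thesis using False JI bI aJ b0 unfolding abs_le_iff by simp
  qed
  then have "exp (- \<beta> * x) * x powr (- \<nu>) * \<bar>\<alpha> * ?J - \<beta> * ?I\<bar>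
      \<le> exp (- \<beta> * x) * x powr (- \<nu>) * ((if \<beta> \<ge> 0 then 1 else 2) * (\<alpha> * ?I))"
    by (rule mult_left_mono) simp
  moreover have "\<bar>V' x\<bar> = exp (- \<beta> * x) * x powr (- \<nu>) * \<bar>\<alpha> * ?J - \<beta> * ?I\<bar>"
    unfolding V'_def by (simp add: abs_mult)
  moreover have "(if \<beta> \<ge> 0 then 1 else 2) * \<alpha> * V x = exp (- \<beta> * x) * x powr (- \<nu>) * ((if \<beta> \<ge> 0 then 1 else 2) * (\<alpha> * ?I))"
    unfolding V_def by simp
  ultimately show ?thesis by (simp only:)
qed

lemma F_bound:
  assumes x: "x > 0"
  shows "\<bar>F x\<bar> \<le> G * (1 / (\<alpha> * (2 * \<nu> + 1)) + c * J)"
proof -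
  have "\<bar>F x\<bar> \<le> \<bar>U x * P x\<bar> + V x * \<bar>R x\<bar>"
    unfolding F_def using V_nonneg[OF x] abs_triangle_ineq[of "U x * P x" "V x * R x"] by (simp add: abs_mult)
  then show ?thesis using U_P_bound[OF x] V_R_bound[OF x] by (simp add: algebra_simps)
qed

lemma F'_bound:
  assumes x: "x > 0"
  shows "\<bar>F' x\<bar> \<le> G * (2 / (2 * \<nu> + 1) + (if \<beta> \<ge> 0 then 1 else 2) * \<alpha> * (c * J))"
proof -
  let ?m = "if \<beta> \<ge> 0 then 1 else 2 :: real"
  have "\<bar>F' x\<bar> \<le> \<bar>U' x * P x\<bar> + \<bar>V' x\<bar> * \<bar>R x\<bar>"
    unfolding F'_def using abs_triangle_ineq[of "U' x * P x" "V' x * R x"] by (simp add: abs_mult)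
  moreover have "\<bar>V' x\<bar> * \<bar>R x\<bar> \<le> ?m * \<alpha> * V x * \<bar>R x\<bar>"
    by (rule mult_right_mono[OF V'_bound[OF x]]) simp
  moreover have "?m * \<alpha> * (V x * \<bar>R x\<bar>) \<le> ?m * \<alpha> * (G * (c * J))"
    using \<alpha> by (intro mult_left_mono V_R_bound x) auto
  ultimately have "\<bar>F' x\<bar> \<le> G * 2 / (2 * \<nu> + 1) + ?m * \<alpha> * (G * (c * J))"
    using U'_P_bound[OF x] by (simp only: mult.assoc)
  also have "\<dots> = G * (2 / (2 * \<nu> + 1) + ?m * \<alpha> * (c * J))" by (simp add: algebra_simps)
  finally show ?thesis .
qed

section \<open>Differentiability of F for x > 0 and its limit at 0\<close>

lemma U_deriv:
  assumes x: "x > 0"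
  shows "(U has_real_derivative U' x) (at x)"
proof -
  have ax: "\<alpha> * x > 0" using \<alpha> x by simp
  define A Q where "A = bessel_K \<nu>" and "Q = (\<lambda>x::real. x powr (- \<nu>))"
  note d = bessel_K_deriv_up[OF ax, of \<nu>, folded A_def]
  have dQ: "(Q has_real_derivative - \<nu> / x * Q x) (at x)"
    unfolding Q_def by (rule DERIV_powr_pos[OF x])
  have m: "((\<lambda>x. \<alpha> * x) has_real_derivative \<alpha>) (at x)" by (auto intro!: derivative_eq_intros)
  have "((\<lambda>x. exp (- \<beta> * x) * Q x * A (\<alpha> * x)) has_real_derivative
      - (exp (- \<beta> * x) * Q x * (\<beta> * A (\<alpha> * x) + \<alpha> * bessel_K (\<nu> + 1) (\<alpha> * x)))) (at x)"
    using x \<alpha> by (auto intro!: derivative_eq_intros DERIV_chain2[OF d m] dQ) (simp add: field_simps)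
  then show ?thesis unfolding A_def Q_def U_def[abs_def] U'_def .
qed

lemma V_deriv:
  assumes x: "x > 0"
  shows "(V has_real_derivative V' x) (at x)"
proof -
  have ax: "\<alpha> * x > 0" using \<alpha> x by simp
  define A Q where "A = bessel_I \<nu>" and "Q = (\<lambda>x::real. x powr (- \<nu>))"
  note d = bessel_I_deriv_up[OF \<nu>1(1) ax, folded A_def]
  have dQ: "(Q has_real_derivative - \<nu> / x * Q x) (at x)"
    unfolding Q_def by (rule DERIV_powr_pos[OF x])
  have m: "((\<lambda>x. \<alpha> * x) has_real_derivative \<alpha>) (at x)" by (auto intro!: derivative_eq_intros)
  have "((\<lambda>x. exp (- \<beta> * x) * Q x * A (\<alpha> * x)) has_real_derivative
      exp (- \<beta> * x) * Q x * (\<alpha> * bessel_I (\<nu> + 1) (\<alpha> * x) - \<beta> * A (\<alpha> * x))) (at x)"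
    using x \<alpha> by (auto intro!: derivative_eq_intros DERIV_chain2[OF d m] dQ) (simp add: field_simps)
  then show ?thesis unfolding A_def Q_def V_def[abs_def] V'_def .
qed

lemma isCont_wI: "x > 0 \<Longrightarrow> isCont wI x"
  unfolding wI_def[abs_def] using \<alpha>
  by (intro continuous_intros isCont_o2[OF _ DERIV_isCont[OF bessel_I_deriv_up[OF \<nu>1(1)]]]) auto

lemma isCont_wK: "x > 0 \<Longrightarrow> isCont wK x"
  unfolding wK_def[abs_def] using \<alpha>
  by (intro continuous_intros isCont_o2[OF _ DERIV_isCont[OF bessel_K_deriv]]) auto

lemma integrable_wI_g: "x > 0 \<Longrightarrow> set_integrable lborel {0<..<x} (\<lambda>t. wI t * g t)"
  by (rule set_integral_mult_bounded(1)[OF integrable_wI(1) g_measurable g_bound])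

lemma integrable_wK_g: "set_integrable lborel {0<..} (\<lambda>t. wK t * g t)"
  by (rule set_integral_mult_bounded(1)[OF integrable_wK g_measurable g_bound])

lemma P_increment:
  assumes "x > 0" "y > 0"
  shows "P y = P x + (LBINT t=x..y. wI t * g t)"
proof -
  have "(LBINT t=ereal 0..ereal x. wI t * g t) + (LBINT t=ereal x..ereal y. wI t * g t) = (LBINT t=ereal 0..ereal y. wI t * g t)"
  proof (rule interval_integral_sum)
    have "einterval (min (ereal 0) (min (ereal x) (ereal y))) (max (ereal 0) (max (ereal x) (ereal y))) = {0<..<max x y}"
      using assms by (auto simp: einterval_def min_def max_def)
    then show "interval_lebesgue_integrable lborel (min (ereal 0) (min (ereal x) (ereal y))) (max (ereal 0) (max (ereal x) (ereal y))) (\<lambda>t. wI t * g t)"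
      unfolding interval_lebesgue_integrable_def
      using assms integrable_wI_g[of "max x y"] by (auto simp: min_def max_def split: if_splits)
  qed
  then show ?thesis using assms unfolding P_def by (simp add: interval_lebesgue_integral_def)
qed

lemma R_increment:
  assumes "x > 0" "y > 0"
  shows "R y = R x - (LBINT t=x..y. wK t * g t)"
proof -
  have "(LBINT t=ereal x..ereal y. wK t * g t) + (LBINT t=ereal y..\<infinity>. wK t * g t) = (LBINT t=ereal x..\<infinity>. wK t * g t)"
  proof (rule interval_integral_sum)
    have i: "set_integrable lborel {min x y<..} (\<lambda>t. wK t * g t)"
      by (rule set_integrable_subset[OF integrable_wK_g]) (use assms in auto)
    have "min (ereal x) (min (ereal y) \<infinity>) = ereal (min x y)" "max (ereal x) (max (ereal y) \<infinity>) = \<infinity>"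
      by (auto simp: min_def max_def)
    then show "interval_lebesgue_integrable lborel (min (ereal x) (min (ereal y) \<infinity>)) (max (ereal x) (max (ereal y) \<infinity>)) (\<lambda>t. wK t * g t)"
      using i by (simp only: interval_integrable_to_infinity_eq)
  qed
  then show ?thesis unfolding R_def by (simp add: interval_integral_to_infinity_eq)
qed

text \<open>The terms coming from differentiating the limits of integration cancel because
  \<open>U w\<^sub>I = V w\<^sub>K\<close>; so no continuity of \<open>g\<close> is needed.\<close>

lemma F_deriv:
  assumes x: "x > 0"
  shows "(F has_real_derivative F' x) (at x)"
proof -
  \<comment> \<open>The remainder after freezing the integrals \<open>P\<close> and \<open>R\<close>
    at x. It remains to show that it has derivative 0 at x.\<close>
  define E where "E y = F y - (U y * P x + V y * R x)" for y
  let ?k = "\<lambda>y t. U y * wI t - V y * wK t"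
  have E: "E y = (LBINT t=x..y. ?k y t * g t)" and iE: "set_integrable lborel {min x y<..<max x y} (\<lambda>t. ?k y t * g t)"
    if y: "y > 0" for y
  proof -
    have iI: "set_integrable lborel {min x y<..<max x y} (\<lambda>t. wI t * g t)"
      by (rule set_integrable_subset[OF integrable_wI_g[of "max x y"]]) (use x y in auto)
    have iK: "set_integrable lborel {min x y<..<max x y} (\<lambda>t. wK t * g t)"
      by (rule set_integrable_subset[OF integrable_wK_g]) (use x y in auto)
    have il: "interval_lebesgue_integrable lborel (ereal x) (ereal y) f"
      if "set_integrable lborel {min x y<..<max x y} f" for f :: "real \<Rightarrow> real"
      using that unfolding interval_lebesgue_integrable_def by (auto simp: min_def max_def split: if_splits)
    have k: "?k y t * g t = U y * (wI t * g t) - V y * (wK t * g t)" for t by (simp add: algebra_simps)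
    show "set_integrable lborel {min x y<..<max x y} (\<lambda>t. ?k y t * g t)"
      unfolding k using iI iK by (intro set_integral_diff set_integrable_mult_right) auto
    have "(LBINT t=x..y. ?k y t * g t) = U y * (LBINT t=x..y. wI t * g t) - V y * (LBINT t=x..y. wK t * g t)"
      unfolding k
      by (subst interval_lebesgue_integral_diff(2))
        (auto intro!: il iI iK set_integrable_mult_right)
    then show "E y = (LBINT t=x..y. ?k y t * g t)"
      unfolding E_def F_def P_increment[OF x y] R_increment[OF x y] by (simp add: algebra_simps)
  qed
  have E0: "E x = 0" by (simp add: E_def F_def)
  have k0: "?k x x = 0"
    unfolding U_def V_def wI_def wK_def by simp
  \<comment> \<open>\<open>?k\<close> as a function of the pair (y, t). It vanishes at (x, x), and
    joint continuity makes it small for all t between x and y at once.\<close>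
  define kk where "kk = (\<lambda>z. U (fst z) * wI (snd z) - V (fst z) * wK (snd z))"
  have fs: "isCont fst (x, x)" "isCont snd (x, x)"
    using isCont_fst[of "(x, x)" "\<lambda>z. z"] isCont_snd[of "(x, x)" "\<lambda>z. z"] by simp_all
  have "isCont (\<lambda>z. U (fst z)) (x, x)" "isCont (\<lambda>z. V (fst z)) (x, x)"
    "isCont (\<lambda>z. wI (snd z)) (x, x)" "isCont (\<lambda>z. wK (snd z)) (x, x)"
    using DERIV_isCont[OF U_deriv[OF x]] DERIV_isCont[OF V_deriv[OF x]] isCont_wI[OF x] isCont_wK[OF x]
    by (auto intro!: isCont_o2[OF fs(1)] isCont_o2[OF fs(2)])
  then have "isCont kk (x, x)"
    unfolding kk_def by (intro isCont_diff isCont_mult)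
  moreover have "kk (x, x) = 0" using k0 by (simp add: kk_def)
  ultimately have k: "(kk \<longlongrightarrow> 0) (nhds (x, x))"
    using tendsto_at_iff_tendsto_nhds[of kk "(x, x)"] by (simp add: isCont_def)
  have "((\<lambda>h. (E (x + h) - E x) / h) \<longlongrightarrow> 0) (at 0)"
  proof (rule LIM_I)
    fix \<epsilon> :: real assume \<epsilon>: "\<epsilon> > 0"
    \<comment> \<open>\<open>G + 1\<close> rather than \<open>G\<close>, because \<open>G\<close>
      may be 0.\<close>
    define \<eta> where "\<eta> = \<epsilon> / (2 * (G + 1))"
    have \<eta>: "\<eta> > 0" using \<epsilon> G_nonneg by (simp add: \<eta>_def)
    from tendstoD[OF k \<eta>] obtain \<delta> where \<delta>: "\<delta> > 0"
      and close: "\<And>z. dist z (x, x) < \<delta> \<Longrightarrow> \<bar>kk z\<bar> < \<eta>"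
      unfolding eventually_nhds_metric by auto
    \<comment> \<open>Both coordinates of (x + h, t) differ from x by at most |h|, hence half of
      delta; the bound x keeps x + h positive.\<close>
    have "norm ((E (x + h) - E x) / h - 0) < \<epsilon>" if h: "h \<noteq> 0" "norm (h - 0) < min (\<delta> / 2) x" for h
    proof -
      have y: "x + h > 0" using h by (auto simp: abs_if split: if_splits)
      have "\<bar>E (x + h)\<bar> \<le> (\<eta> * G) * \<bar>x + h - x\<bar>"
        unfolding E[OF y]
      proof (rule interval_integral_abs_bound[OF iE[OF y]])
        fix t assume t: "min x (x + h) < t" "t < max x (x + h)"
        have "dist (x + h, t) (x, x) \<le> \<bar>h\<bar> + \<bar>t - x\<bar>"
          by (simp add: dist_Pair_Pair dist_real_def sqrt_sum_squares_le_sum_abs)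
        also have "\<dots> < \<delta>" using t h by (auto simp: min_def max_def split: if_splits)
        finally have "\<bar>?k (x + h) t\<bar> < \<eta>" using close unfolding kk_def by fastforce
        then show "\<bar>?k (x + h) t * g t\<bar> \<le> \<eta> * G"
          unfolding abs_mult using g_bound[of t] \<eta> by (intro mult_mono) auto
      qed
      then have "\<bar>E (x + h)\<bar> / \<bar>h\<bar> \<le> \<eta> * G" using h by (simp add: divide_le_eq)
      also have "\<dots> < \<epsilon>"
        using \<epsilon> G_nonneg by (simp add: \<eta>_def divide_less_eq)
      finally show ?thesis by (simp add: E0)
    qed
    then show "\<exists>s>0. \<forall>h. h \<noteq> 0 \<and> norm (h - 0) < s \<longrightarrow> norm ((E (x + h) - E x) / h - 0) < \<epsilon>"
      using \<delta> x by (intro exI[of _ "min (\<delta> / 2) x"]) auto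
  qed
  then have "(E has_real_derivative 0) (at x)" by (simp add: DERIV_def)
  then have "((\<lambda>y. E y + (U y * P x + V y * R x)) has_real_derivative 0 + (U' x * P x + V' x * R x)) (at x)"
    by (intro DERIV_add DERIV_cmult_right U_deriv V_deriv x)
  then show ?thesis by (simp add: E_def F'_def)
qed

text \<open>The K-part vanishes at 0, where x I_nu K_nu does, and \<open>V\<close> tends to
  \<open>c\<close>. This limit is what has to match between the two half-lines.\<close>

lemma F_tendsto_0: "(F \<longlongrightarrow> c * (LBINT t:{0<..}. wK t * g t)) (at_right 0)"
proof -
  have "((\<lambda>x. U x * P x) \<longlongrightarrow> 0) (at_right 0)"
  proof (rule Lim_null_comparison)
    have "((\<lambda>x. \<alpha> * x * bessel_I \<nu> (\<alpha> * x) * bessel_K \<nu> (\<alpha> * x)) \<longlongrightarrow> 0) (at_right 0)"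
      using filterlim_compose[OF tendsto_bessel_I_K_0[OF \<nu>] filterlim_mult_at_right_0[OF \<alpha>]] .
    then show "((\<lambda>x. (\<alpha> * x * bessel_I \<nu> (\<alpha> * x) * bessel_K \<nu> (\<alpha> * x)) * (2 * G / (\<alpha> * (2 * \<nu> + 1)))) \<longlongrightarrow> 0) (at_right 0)"
      by (rule tendsto_mult_left_zero)
    have "norm (U x * P x) \<le> (\<alpha> * x * bessel_I \<nu> (\<alpha> * x) * bessel_K \<nu> (\<alpha> * x)) * (2 * G / (\<alpha> * (2 * \<nu> + 1)))"
      if x: "x > 0" for x
    proof -
      have ax: "\<alpha> * x > 0" using \<alpha> x by simp
      have "G * (x * (bessel_I \<nu> (\<alpha> * x) + bessel_I (\<nu> + 1) (\<alpha> * x)) * bessel_K \<nu> (\<alpha> * x)) / (2 * \<nu> + 1)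
          \<le> G * (x * (bessel_I \<nu> (\<alpha> * x) + bessel_I \<nu> (\<alpha> * x)) * bessel_K \<nu> (\<alpha> * x)) / (2 * \<nu> + 1)"
        using \<nu> x bessel_K_scaled_nonneg[OF x]
        by (intro divide_right_mono mult_left_mono mult_right_mono add_left_mono bessel_I_antimono_order G_nonneg ax) auto
      also have "\<dots> = (\<alpha> * x * bessel_I \<nu> (\<alpha> * x) * bessel_K \<nu> (\<alpha> * x)) * (2 * G / (\<alpha> * (2 * \<nu> + 1)))"
        using \<alpha> by simp
      finally show ?thesis using U_P_bound_product[OF x] by simp
    qed
    then show "\<forall>\<^sub>F x in at_right 0. norm (U x * P x) \<le> (\<alpha> * x * bessel_I \<nu> (\<alpha> * x) * bessel_K \<nu> (\<alpha> * x)) * (2 * G / (\<alpha> * (2 * \<nu> + 1)))"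
      unfolding eventually_at_right_field by (intro exI[of _ 1]) auto
  qed
  moreover have "(V \<longlongrightarrow> c) (at_right 0)"
  proof -
    have "((\<lambda>x. exp (- \<beta> * x) * (\<alpha> powr \<nu> * ((\<alpha> * x) powr (- \<nu>) * bessel_I \<nu> (\<alpha> * x))))
        \<longlongrightarrow> exp (- \<beta> * 0) * (\<alpha> powr \<nu> * (1 / (2 powr \<nu> * Gamma (\<nu> + 1))))) (at_right 0)"
      by (intro tendsto_intros filterlim_compose[OF tendsto_bessel_I_0[OF \<nu>1(1)] filterlim_mult_at_right_0[OF \<alpha>]])
    then have "((\<lambda>x. exp (- \<beta> * x) * (\<alpha> powr \<nu> * ((\<alpha> * x) powr (- \<nu>) * bessel_I \<nu> (\<alpha> * x)))) \<longlongrightarrow> c) (at_right 0)"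
      by (simp add: c_def)
    moreover have "exp (- \<beta> * x) * (\<alpha> powr \<nu> * ((\<alpha> * x) powr (- \<nu>) * bessel_I \<nu> (\<alpha> * x))) = V x" if "x > 0" for x
    proof -
      have "\<alpha> powr \<nu> * \<alpha> powr (- \<nu>) = 1" using \<alpha> by (simp flip: powr_add)
      moreover have "(\<alpha> * x) powr (- \<nu>) = \<alpha> powr (- \<nu>) * x powr (- \<nu>)" using \<alpha> that by (simp add: powr_mult)
      ultimately have "\<alpha> powr \<nu> * (\<alpha> * x) powr (- \<nu>) = x powr (- \<nu>)"
        by (simp only: mult.assoc[symmetric] mult_1_left)
      then show ?thesis unfolding V_def by (simp only: mult.assoc[symmetric])
    qed
    ultimately show ?thesis
      by (elim Lim_transform_eventually) (auto simp: eventually_at_filter)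
  qed
  moreover have "(R \<longlongrightarrow> (LBINT t:{0<..}. wK t * g t)) (at_right 0)"
  proof -
    have i1: "set_integrable lborel {0<..1} (\<lambda>t. wK t * g t)"
      by (rule set_integrable_subset[OF integrable_wK_g]) auto
    have i2: "set_integrable lborel {1<..} (\<lambda>t. wK t * g t)"
      by (rule set_integrable_subset[OF integrable_wK_g]) auto
    \<comment> \<open>Cutting at 1 leaves a bounded interval, only whose left end moves to
      0.\<close>
    have "((\<lambda>x. (LBINT t:{x..1}. wK t * g t) + (LBINT t:{1<..}. wK t * g t))
        \<longlongrightarrow> (LBINT t:{0<..1}. wK t * g t) + (LBINT t:{1<..}. wK t * g t)) (at_right 0)"
      by (intro tendsto_add tendsto_const tendsto_set_lebesgue_integral_at_right i1) auto
    moreover have "(LBINT t:{0<..1}. wK t * g t) + (LBINT t:{1<..}. wK t * g t) = (LBINT t:{0<..}. wK t * g t)"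
    proof -
      have "{0<..1} \<union> {1<..} = {0::real<..}" by auto
      then show ?thesis using set_integral_Un[OF _ i1 i2] by (simp add: disjoint_iff)
    qed
    moreover have "(LBINT t:{x..1}. wK t * g t) + (LBINT t:{1<..}. wK t * g t) = R x" if "0 < x" "x < 1" for x
    proof -
      have "(LBINT t:{x..1}. wK t * g t) = (LBINT t:{x<..1}. wK t * g t)"
        unfolding set_lebesgue_integral_def
        by (rule integral_discrete_difference[of "{x}"]) (auto simp: indicator_def)
      moreover have "{x<..1} \<union> {1<..} = {x<..}" using that by auto
      moreover have "set_integrable lborel {x<..1} (\<lambda>t. wK t * g t)"
        by (rule set_integrable_subset[OF i1]) (use that in auto)
      ultimately show ?thesis unfolding R_def using set_integral_Un[OF _ _ i2, of "{x<..1}"] by (simp add: disjoint_iff)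
    qed
    then have "\<forall>\<^sub>F x in at_right 0. (LBINT t:{x..1}. wK t * g t) + (LBINT t:{1<..}. wK t * g t) = R x"
      unfolding eventually_at_right_field by (intro exI[of _ 1]) auto
    ultimately show ?thesis by (auto elim: Lim_transform_eventually)
  qed
  ultimately have "((\<lambda>x. U x * P x + V x * R x) \<longlongrightarrow> 0 + c * (LBINT t:{0<..}. wK t * g t)) (at_right 0)"
    by (intro tendsto_intros)
  then show ?thesis by (simp add: F_def[abs_def])
qed

end

section \<open>Both half-lines and the constants\<close>

text \<open>For beta < 0 the weight on this half-line is pointwise below its reflection, so
  \<open>J\<close> is at most half of the total mass \<open>T\<close>. This pays for the factor 2 in
  \<open>V'_bound\<close>.\<close>

lemma (in vg_half_line) J_weighted_le:
  assumes i: "set_integrable lborel {0<..} (\<lambda>t. exp (- \<beta> * t) * t powr \<nu> * bessel_K \<nu> (\<alpha> * t))"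
    and T: "T = J + (LBINT t:{0<..}. exp (- \<beta> * t) * t powr \<nu> * bessel_K \<nu> (\<alpha> * t))"
  shows "(if \<beta> \<ge> 0 then 1 else 2) * J \<le> T"
proof -
  let ?J' = "LBINT t:{0<..}. exp (- \<beta> * t) * t powr \<nu> * bessel_K \<nu> (\<alpha> * t)"
  have "0 \<le> ?J'"
    unfolding set_lebesgue_integral_def
    by (rule integral_nonneg_AE) (auto simp: indicator_def bessel_K_scaled_nonneg)
  moreover have "J \<le> ?J'" if "\<beta> < 0"
    unfolding J_def
  proof (rule set_integral_mono[OF integrable_wK i])
    fix t :: real assume t: "t \<in> {0<..}"
    then have "\<beta> * t \<le> - \<beta> * t" using that by (simp add: mult_nonpos_nonneg)
    then show "wK t \<le> exp (- \<beta> * t) * t powr \<nu> * bessel_K \<nu> (\<alpha> * t)"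
      unfolding wK_def using t bessel_K_scaled_nonneg by (intro mult_right_mono) auto
  qed
  ultimately show ?thesis unfolding T by auto
qed

text \<open>Log-convexity twice: Gamma(x) Gamma(2-x) >= Gamma(1)^2 = 1, and on the interval from 1/2
  to 3/2 Gamma is at most its larger endpoint value sqrt(pi), which bounds Gamma(2-x).\<close>

lemma Gamma_ge_inverse_sqrt_pi:
  assumes x: "1/2 < x" "x < (3/2::real)"
  shows "1 / sqrt pi \<le> Gamma x"
proof -
  let ?f = "ln \<circ> Gamma :: real \<Rightarrow> real"
  have G32: "Gamma (3/2 :: real) = sqrt pi / 2"
  proof -
    have "(1/2 :: real) \<notin> \<int>\<^sub>\<le>\<^sub>0" using nonpos_Ints_nonpos[of "1/2 :: real"] by auto
    then show ?thesis using Gamma_plus1[of "1/2 :: real"] by (simp add: Gamma_one_half_real)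
  qed
  have "?f ((1 - (3/2 - x)) * (1/2) + (3/2 - x) * (3/2)) \<le> (1 - (3/2 - x)) * ?f (1/2) + (3/2 - x) * ?f (3/2)"
    using x by (intro convex_onD[OF log_convex_Gamma_real, where t = "3/2 - x" and x = "1/2" and y = "3/2",
          unfolded real_scaleR_def]) auto
  also have "(1 - (3/2 - x)) * (1/2) + (3/2 - x) * (3/2) = 2 - x" by (simp add: field_simps)
  also have "(1 - (3/2 - x)) * ?f (1/2) + (3/2 - x) * ?f (3/2) = ln (sqrt pi) - (3/2 - x) * ln 2"
    by (simp add: G32 Gamma_one_half_real ln_div algebra_simps)
  also have "\<dots> \<le> ln (sqrt pi)" using x by simp
  finally have 2: "?f (2 - x) \<le> ln (sqrt pi)" .
  have "?f ((1 - 1/2) * x + 1/2 * (2 - x)) \<le> (1 - 1/2) * ?f x + 1/2 * ?f (2 - x)"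
    using x by (intro convex_onD[OF log_convex_Gamma_real, where t = "1/2" and x = x and y = "2 - x",
          unfolded real_scaleR_def]) auto
  also have "(1 - 1/2) * x + 1/2 * (2 - x) = 1" by (simp add: field_simps)
  finally have "0 \<le> ?f x + ?f (2 - x)" by simp
  then have "ln (1 / sqrt pi) \<le> ln (Gamma x)" using 2 by (simp add: ln_div)
  moreover have "0 < Gamma x" using x by (intro Gamma_real_pos) simp
  ultimately show ?thesis using pi_gt_zero by (subst (asm) ln_le_cancel_iff) auto
qed

text \<open>The branch r >= 2 of \<open>vg_const\<close> taken for all r. It is the constant that
  the estimates actually yield.\<close>

definition vg_const_base :: "real \<Rightarrow> real \<Rightarrow> real \<Rightarrow> real" where
  "vg_const_base r \<theta> \<sigma> = sqrt pi * Gamma (r / 2) / Gamma ((r + 1) / 2) * (1 + \<theta>\<^sup>2 / \<sigma>\<^sup>2) powr (r / 2)"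

text \<open>For r < 2: with b = |theta| / sqrt(theta^2 + sigma^2) one has 1 + theta^2/sigma^2 = 1/(1
  - b^2) <= 1/(1 - b), since 0 <= b < 1. The Gamma quotient is controlled by sqrt(pi) /
  Gamma((r+1)/2) <= pi < 6.\<close>

lemma vg_const_base_le:
  assumes r: "r > 0" and \<sigma>: "\<sigma> > 0"
  shows "vg_const_base r \<theta> \<sigma> \<le> vg_const r \<theta> \<sigma>"
proof (cases "r \<ge> 2")
  case True
  then show ?thesis by (simp add: vg_const_def vg_const_base_def)
next
  case False
  \<comment> \<open>Spelled as in \<open>vg_const\<close>, so that the convention at theta = 0
    matches.\<close>
  define b where "b = (if \<theta> = 0 then 0 else 1 / (1 + \<sigma>\<^sup>2 / \<theta>\<^sup>2) powr (1 / 2))"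
  have b2: "b\<^sup>2 = \<theta>\<^sup>2 / (\<theta>\<^sup>2 + \<sigma>\<^sup>2)"
  proof (cases "\<theta> = 0")
    case False
    then have "0 \<le> 1 + \<sigma>\<^sup>2 / \<theta>\<^sup>2" by (simp add: add_nonneg_nonneg)
    then have "((1 + \<sigma>\<^sup>2 / \<theta>\<^sup>2) powr (1 / 2))\<^sup>2 = 1 + \<sigma>\<^sup>2 / \<theta>\<^sup>2"
      by (simp add: powr_half_sqrt)
    then show ?thesis using False \<sigma> by (simp add: b_def power_divide field_simps)
  qed (simp add: b_def)
  have b0: "0 \<le> b" by (simp add: b_def)
  have pos: "0 < \<theta>\<^sup>2 + \<sigma>\<^sup>2" using \<sigma> by (simp add: add_nonneg_pos)
  have "b\<^sup>2 < 1" using pos \<sigma> by (simp add: b2 divide_less_eq)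
  then have b1: "b < 1" using b0 by (simp add: power2_eq_square) (metis mult_mono not_le mult_1 zero_le_one)
  have q: "1 + \<theta>\<^sup>2 / \<sigma>\<^sup>2 = inverse (1 - b\<^sup>2)"
    using pos \<sigma> by (simp add: b2 field_simps)
  have "1 - b \<le> 1 - b\<^sup>2" using b0 b1 by (simp add: power2_eq_square mult_left_le)
  then have "inverse (1 - b\<^sup>2) \<le> inverse (1 - b)" using b1 by (intro le_imp_inverse_le) auto
  then have "inverse (1 - b\<^sup>2) powr (r / 2) \<le> inverse (1 - b) powr (r / 2)"
    using r b1 \<open>b\<^sup>2 < 1\<close> by (intro powr_mono2) auto
  also have "inverse (1 - b) powr (r / 2) = (1 - b) powr (- r / 2)"
    using b1 by (simp add: powr_minus inverse_powr)
  finally have P: "(1 + \<theta>\<^sup>2 / \<sigma>\<^sup>2) powr (r / 2) \<le> (1 - b) powr (- r / 2)" unfolding q .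
  have "1 / sqrt pi \<le> Gamma ((r + 1) / 2)" using False r by (intro Gamma_ge_inverse_sqrt_pi) auto
  moreover have "0 < Gamma ((r + 1) / 2)" using r by (intro Gamma_real_pos) simp
  ultimately have "sqrt pi / Gamma ((r + 1) / 2) \<le> pi"
    using mult_left_mono[of "1 / sqrt pi" "Gamma ((r + 1) / 2)" pi] by (simp add: field_simps real_div_sqrt)
  then have "sqrt pi / Gamma ((r + 1) / 2) \<le> 6" using pi_less_4 by linarith
  moreover have G: "0 < Gamma (r / 2)" using r by (intro Gamma_real_pos) simp
  ultimately have "sqrt pi / Gamma ((r + 1) / 2) * Gamma (r / 2) \<le> 6 * Gamma (r / 2)"
    by (intro mult_right_mono) auto
  then have "(sqrt pi / Gamma ((r + 1) / 2) * Gamma (r / 2)) * (1 + \<theta>\<^sup>2 / \<sigma>\<^sup>2) powr (r / 2)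
      \<le> (6 * Gamma (r / 2)) * (1 - b) powr (- r / 2)"
    by (rule mult_mono[OF _ P]) (use G in auto)
  then show ?thesis using False by (simp add: vg_const_def vg_const_base_def b_def)
qed

text \<open>By the mean value theorem, difference quotients to the right of a are values of f'. It
  handles the point 0, where the formula for the derivative does not apply.\<close>

lemma bounded_deriv_at_limit:
  fixes f :: "real \<Rightarrow> real"
  assumes d: "\<And>x. x > a \<Longrightarrow> (f has_real_derivative f' x) (at x)" and B: "\<And>x. x > a \<Longrightarrow> \<bar>f' x\<bar> \<le> B"
    and D: "(f has_real_derivative D) (at a)"
  shows "\<bar>D\<bar> \<le> B"
proof -
  have "at_right (0::real) \<le> at 0" by (rule at_le) simp
  then have lim: "((\<lambda>h. \<bar>(f (a + h) - f a) / h\<bar>) \<longlongrightarrow> \<bar>D\<bar>) (at_right 0)"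
    using D unfolding DERIV_def by (intro tendsto_rabs) (rule tendsto_mono)
  have "\<bar>(f (a + h) - f a) / h\<bar> \<le> B" if h: "h > 0" for h
  proof -
    have "continuous_on {a..a + h} f"
      unfolding continuous_on_eq_continuous_within
    proof
      fix t assume "t \<in> {a..a + h}"
      then have "isCont f t" using DERIV_isCont[OF D] DERIV_isCont[OF d] by (cases "t = a") auto
      then show "continuous (at t within {a..a + h}) f" by (rule continuous_at_imp_continuous_at_within)
    qed
    moreover have "f differentiable (at t)" if "a < t" for t
      using d[OF that] by (auto simp: real_differentiable_def)
    ultimately obtain l z where z: "a < z" "DERIV f z :> l" "f (a + h) - f a = (a + h - a) * l"
      using MVT[of a "a + h" f] h by auto
    then have "l = f' z" using DERIV_unique d by blast
    then show ?thesis using z h B[of z] by simp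
  qed
  then show ?thesis
    by (intro tendsto_upperbound[OF lim]) (auto simp: eventually_at_right_field intro!: exI[of _ "1::real"])
qed

text \<open>The origin of C: the left side is alpha times the limit of \<open>V\<close> at 0 times
  the total mass of the K-weight. With a = alpha s = 1 + theta^2/sigma^2 one has alpha sigma =
  sqrt(a), so the powers collect to a^(nu + 1/2) = a^(r/2).\<close>

lemma vg_total_mass_constant:
  fixes r \<theta> \<sigma> :: real
  assumes r: "r > 0" and \<sigma>: "\<sigma> > 0"
  defines "\<nu> \<equiv> (r - 1) / 2" and "s \<equiv> sqrt (\<theta>\<^sup>2 + \<sigma>\<^sup>2)"
  defines "\<alpha> \<equiv> s / \<sigma>\<^sup>2"
  shows "\<alpha> * (\<alpha> powr \<nu> / (2 powr \<nu> * Gamma (\<nu> + 1)) * (\<sigma> * sqrt pi * Gamma (r / 2) * (2 * s) powr \<nu>))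
    = vg_const_base r \<theta> \<sigma>"
proof -
  have s: "s > 0" "s\<^sup>2 = \<theta>\<^sup>2 + \<sigma>\<^sup>2" using \<sigma> by (simp_all add: s_def add_nonneg_pos)
  have \<alpha>: "\<alpha> > 0" using s \<sigma> by (simp add: \<alpha>_def)
  have \<alpha>s: "\<alpha> * s = 1 + \<theta>\<^sup>2 / \<sigma>\<^sup>2"
    using s(2) \<sigma> by (simp add: \<alpha>_def power2_eq_square field_simps)
  have "(\<alpha> * \<sigma>)\<^sup>2 = \<alpha> * s"
    using s \<sigma> by (simp add: \<alpha>_def power2_eq_square field_simps)
  then have "\<alpha> * \<sigma> = sqrt (\<alpha> * s)"
    using \<alpha> \<sigma> by (metis less_imp_le mult_pos_pos real_sqrt_unique)
  also have "\<dots> = (\<alpha> * s) powr (1 / 2)" using \<alpha> s by (simp add: powr_half_sqrt)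
  finally have as2: "\<alpha> * \<sigma> * (\<alpha> * s) powr \<nu> = (\<alpha> * s) powr (r / 2)"
    by (simp add: \<nu>_def diff_divide_distrib flip: powr_add)
  have "\<alpha> powr \<nu> / 2 powr \<nu> * (2 * s) powr \<nu> = (\<alpha> * s) powr \<nu>"
    using \<alpha> s by (simp add: powr_mult)
  moreover have "\<nu> + 1 = (r + 1) / 2" by (simp add: \<nu>_def field_simps)
  moreover have "\<alpha> * (\<alpha> powr \<nu> / (2 powr \<nu> * Gamma (\<nu> + 1)) * (\<sigma> * sqrt pi * Gamma (r / 2) * (2 * s) powr \<nu>))
    = sqrt pi * Gamma (r / 2) / Gamma (\<nu> + 1) * (\<alpha> * \<sigma> * (\<alpha> powr \<nu> / 2 powr \<nu> * (2 * s) powr \<nu>))"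
    by (simp add: mult_ac)
  ultimately show ?thesis
    unfolding vg_const_base_def \<alpha>s[symmetric] as2[symmetric] by (simp only:)
qed

section \<open>From the explicit formula to the two half-lines\<close>

lemma vg_stein_formula_pos:
  fixes r \<theta> \<sigma> :: real
  assumes \<sigma>: "\<sigma> > 0" and H: "vg_half_line ((r - 1) / 2) (sqrt (\<theta>\<^sup>2 + \<sigma>\<^sup>2) / \<sigma>\<^sup>2) (\<theta> / \<sigma>\<^sup>2) G g" and x: "x > 0"
  shows "vg_stein_formula r \<theta> \<sigma> g x
    = - (1 / \<sigma>\<^sup>2) * vg_half_line.F ((r - 1) / 2) (sqrt (\<theta>\<^sup>2 + \<sigma>\<^sup>2) / \<sigma>\<^sup>2) (\<theta> / \<sigma>\<^sup>2) g x"
proof -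
  define \<nu> \<alpha> \<beta> where "\<nu> = (r - 1) / 2" and "\<alpha> = sqrt (\<theta>\<^sup>2 + \<sigma>\<^sup>2) / \<sigma>\<^sup>2" and "\<beta> = \<theta> / \<sigma>\<^sup>2"
  interpret vg_half_line \<nu> \<alpha> \<beta> G g using H by (simp only: \<nu>_def \<alpha>_def \<beta>_def)
  have \<theta>: "\<theta> * t / \<sigma>\<^sup>2 = \<beta> * t" for t by (simp add: \<beta>_def)
  have P: "(LBINT t=0..x. exp (\<theta> * t / \<sigma>\<^sup>2) * \<bar>t\<bar> powr \<nu> * bessel_I \<nu> (\<alpha> * \<bar>t\<bar>) * g t) = P x"
  proof -
    have "(LBINT t=0..x. exp (\<theta> * t / \<sigma>\<^sup>2) * \<bar>t\<bar> powr \<nu> * bessel_I \<nu> (\<alpha> * \<bar>t\<bar>) * g t)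
        = (LBINT t:{0<..<x}. exp (\<theta> * t / \<sigma>\<^sup>2) * \<bar>t\<bar> powr \<nu> * bessel_I \<nu> (\<alpha> * \<bar>t\<bar>) * g t)"
      using x by (simp add: interval_integral_Ioo)
    also have "\<dots> = P x"
      unfolding P_def by (rule set_lebesgue_integral_cong) (auto simp: wI_def \<theta>)
    finally show ?thesis .
  qed
  have R: "(LBINT t=x..\<infinity>. exp (\<theta> * t / \<sigma>\<^sup>2) * \<bar>t\<bar> powr \<nu> * bessel_K \<nu> (\<alpha> * \<bar>t\<bar>) * g t) = R x"
    unfolding R_def interval_integral_to_infinity_eq
    by (rule set_lebesgue_integral_cong) (use x in \<open>auto simp: wK_def \<theta>\<close>)
  have e: "exp (- \<theta> * x / \<sigma>\<^sup>2) / (\<sigma>\<^sup>2 * \<bar>x\<bar> powr \<nu>) = 1 / \<sigma>\<^sup>2 * (exp (- \<beta> * x) * x powr (- \<nu>))"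
    using x by (simp add: \<beta>_def powr_minus field_simps)
  have "vg_stein_formula r \<theta> \<sigma> g x
      = - (exp (- \<theta> * x / \<sigma>\<^sup>2) / (\<sigma>\<^sup>2 * \<bar>x\<bar> powr \<nu>)) * bessel_K \<nu> (\<alpha> * \<bar>x\<bar>) * P x
        - exp (- \<theta> * x / \<sigma>\<^sup>2) / (\<sigma>\<^sup>2 * \<bar>x\<bar> powr \<nu>) * bessel_I \<nu> (\<alpha> * \<bar>x\<bar>) * R x"
    unfolding vg_stein_formula_def Let_def \<nu>_def[symmetric] \<alpha>_def[symmetric] P R ..
  also have "\<dots> = - (1 / \<sigma>\<^sup>2) * (U x * P x + V x * R x)"
    unfolding e U_def V_def using x by (simp add: algebra_simps add_divide_distrib)
  finally show ?thesis unfolding F_def[symmetric] unfolding \<nu>_def \<alpha>_def \<beta>_def .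
qed

text \<open>Since g has mean zero against w, the integral from -x to infinity is minus the integral
  from -infinity to -x, which reflects into a right tail for -theta. The oriented integral from 0
  changes sign too, so one overall sign remains.\<close>

lemma vg_stein_formula_reflect:
  fixes r \<theta> \<sigma> x :: real
  defines "w \<equiv> \<lambda>t. exp (\<theta> * t / \<sigma>\<^sup>2) * \<bar>t\<bar> powr ((r - 1) / 2) * bessel_K ((r - 1) / 2) (sqrt (\<theta>\<^sup>2 + \<sigma>\<^sup>2) / \<sigma>\<^sup>2 * \<bar>t\<bar>)"
  assumes int: "integrable lborel (\<lambda>t. w t * g t)" and zero: "(\<integral>t. w t * g t \<partial>lborel) = 0"
  shows "vg_stein_formula r \<theta> \<sigma> g (- x) = - vg_stein_formula r (- \<theta>) \<sigma> (\<lambda>t. g (- t)) x"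
proof -
  define \<nu> \<alpha> where "\<nu> = (r - 1) / 2" and "\<alpha> = sqrt (\<theta>\<^sup>2 + \<sigma>\<^sup>2) / \<sigma>\<^sup>2"
  let ?w = "\<lambda>\<theta> t. exp (\<theta> * t / \<sigma>\<^sup>2) * \<bar>t\<bar> powr \<nu> * bessel_K \<nu> (\<alpha> * \<bar>t\<bar>)"
  let ?i = "\<lambda>\<theta> t. exp (\<theta> * t / \<sigma>\<^sup>2) * \<bar>t\<bar> powr \<nu> * bessel_I \<nu> (\<alpha> * \<bar>t\<bar>)"
  have w: "w = ?w \<theta>" by (simp only: w_def \<nu>_def \<alpha>_def)
  have I: "(LBINT t=0..ereal (- x). ?i \<theta> t * g t) = - (LBINT t=0..x. ?i (- \<theta>) t * g (- t))"
    by (subst interval_integral_reflect, subst interval_integral_endpoints_reverse) simp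
  have "(LBINT t=-\<infinity>..ereal (- x). ?w \<theta> t * g t) + (LBINT t=ereal (- x)..\<infinity>. ?w \<theta> t * g t) = (LBINT t=-\<infinity>..\<infinity>. ?w \<theta> t * g t)"
    by (rule interval_integral_sum)
      (use int in \<open>simp add: w interval_lebesgue_integrable_def set_integrable_def einterval_def min_def max_def\<close>)
  also have "\<dots> = 0"
    using zero by (simp add: w interval_lebesgue_integral_def set_lebesgue_integral_def einterval_def)
  also have "(LBINT t=-\<infinity>..ereal (- x). ?w \<theta> t * g t) = (LBINT t=x..\<infinity>. ?w (- \<theta>) t * g (- t))"
    by (subst interval_integral_reflect) simp
  finally have K: "(LBINT t=ereal (- x)..\<infinity>. ?w \<theta> t * g t) = - (LBINT t=x..\<infinity>. ?w (- \<theta>) t * g (- t))"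
    by simp
  show ?thesis
    unfolding vg_stein_formula_def Let_def \<nu>_def[symmetric] power2_minus \<alpha>_def[symmetric] I K
    by (simp only: abs_minus_cancel minus_minus minus_mult_minus mult_minus_left mult_minus_right minus_diff_eq)
qed

lemma integral_eq_half_lines:
  fixes f :: "real \<Rightarrow> real"
  assumes f: "integrable lborel f"
  shows "set_integrable lborel {0<..} f" "set_integrable lborel {0<..} (\<lambda>t. f (- t))"
    and "(\<integral>t. f t \<partial>lborel) = (LBINT t:{0<..}. f t) + (LBINT t:{0<..}. f (- t))"
proof -
  have f': "integrable lborel (\<lambda>t. f (- t))"
    using lborel_integrable_real_affine[OF f, of "-1" 0] by simp
  show "set_integrable lborel {0<..} f" "set_integrable lborel {0<..} (\<lambda>t. f (- t))"
    unfolding set_integrable_def by (intro integrable_mult_indicator f f'; simp)+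
  have "(LBINT t=-\<infinity>..0. f t) + (LBINT t=0..\<infinity>. f t) = (LBINT t=-\<infinity>..\<infinity>. f t)"
    by (rule interval_integral_sum)
      (use f in \<open>simp add: interval_lebesgue_integrable_def set_integrable_def einterval_def\<close>)
  moreover have "(LBINT t=-\<infinity>..0. f t) = (LBINT t=0..\<infinity>. f (- t))"
    by (subst interval_integral_reflect) simp
  moreover have "(LBINT t=-\<infinity>..\<infinity>. f t) = (\<integral>t. f t \<partial>lborel)"
    by (simp add: interval_lebesgue_integral_def set_lebesgue_integral_def einterval_def)
  ultimately show "(\<integral>t. f t \<partial>lborel) = (LBINT t:{0<..}. f t) + (LBINT t:{0<..}. f (- t))"
    by (simp add: interval_lebesgue_integral_0_infty)
qed

text \<open>\<open>T\<close> is the mass of both halves together, which makes the bounds the same on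
  either side. For \<open>F\<close> the estimate \<open>J \<le> T\<close> suffices;
  \<open>F'\<close> needs the weighted one.\<close>

lemma (in vg_half_line) F_F'_uniform_bound:
  assumes J: "(if \<beta> \<ge> 0 then 1 else 2) * J \<le> T" and C: "\<alpha> * (c * T) = C" and x: "x > 0"
  shows "\<bar>F x\<bar> \<le> G / \<alpha> * (1 / (2 * \<nu> + 1) + C)" and "\<bar>F' x\<bar> \<le> G * (2 / (2 * \<nu> + 1) + C)"
proof -
  have J0: "0 \<le> J"
    unfolding J_def set_lebesgue_integral_def
    by (rule integral_nonneg_AE) (auto simp: indicator_def wK_nonneg)
  have JT: "J \<le> T" using J J0 by (auto split: if_splits)
  have "c * J \<le> c * T" by (rule mult_left_mono[OF JT c_nonneg])
  also have "\<dots> = C / \<alpha>" using C \<alpha> by (simp add: field_simps)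
  finally have "G * (1 / (\<alpha> * (2 * \<nu> + 1)) + c * J) \<le> G * (1 / (\<alpha> * (2 * \<nu> + 1)) + C / \<alpha>)"
    by (intro mult_left_mono add_left_mono G_nonneg)
  also have "\<dots> = G / \<alpha> * (1 / (2 * \<nu> + 1) + C)" by (simp add: algebra_simps)
  finally show "\<bar>F x\<bar> \<le> G / \<alpha> * (1 / (2 * \<nu> + 1) + C)" using F_bound[OF x] by linarith
  have "(if \<beta> \<ge> 0 then 1 else 2) * \<alpha> * (c * J) = \<alpha> * c * ((if \<beta> \<ge> 0 then 1 else 2) * J)" by simp
  also have "\<dots> \<le> \<alpha> * c * T" using \<alpha> c_nonneg by (intro mult_left_mono J) simp
  also have "\<dots> = C" using C by (simp add: mult.assoc)
  finally have "G * (2 / (2 * \<nu> + 1) + (if \<beta> \<ge> 0 then 1 else 2) * \<alpha> * (c * J)) \<le> G * (2 / (2 * \<nu> + 1) + C)"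
    by (intro mult_left_mono add_left_mono G_nonneg)
  then show "\<bar>F' x\<bar> \<le> G * (2 / (2 * \<nu> + 1) + C)" using F'_bound[OF x] by linarith
qed

text \<open>The \<open>bounded\<close> conjuncts give the real suprema in \<open>sup_norm_on\<close>
  their meaning. At 0 only continuity is asserted; if f is differentiable there too, that point
  belongs to the set of the last supremum, and \<open>bounded_deriv_at_limit\<close> covers
  it.\<close>

theorem mainTheorem4:
  fixes r \<theta> \<sigma> :: real
    and M :: "'a measure" and Z :: "'a \<Rightarrow> real"
    and h ht f :: "real \<Rightarrow> real"
  assumes "r > 0" and "\<sigma> > 0"
    and "prob_space M"
    and "distributed M lborel Z (\<lambda>x. ennreal (vg_density r \<theta> \<sigma> x))"
    and "h \<in> borel_measurable borel" and "bounded (range h)"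
  defines "ht \<equiv> (\<lambda>x. h x - (LINT \<omega>|M. h (Z \<omega>)))"
    and "f \<equiv> vg_stein_solution r \<theta> \<sigma> ht"
  shows "isCont f 0
    \<and> bounded (range f)
    \<and> sup_norm f \<le> sup_norm ht / sqrt (\<theta>\<^sup>2 + \<sigma>\<^sup>2) * (2 / r + vg_const r \<theta> \<sigma>)
    \<and> (\<forall>x. x \<noteq> 0 \<longrightarrow> f differentiable (at x))
    \<and> bounded (deriv f ` {x. f differentiable (at x)})
    \<and> sup_norm_on {x. f differentiable (at x)} (deriv f)
          \<le> sup_norm ht / \<sigma>\<^sup>2 * (2 / r + vg_const r \<theta> \<sigma>)"
proof -
  note r = \<open>r > 0\<close> and \<sigma> = \<open>\<sigma> > 0\<close>
  interpret prob_space M by fact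
  define \<nu> s \<alpha> \<beta> where "\<nu> = (r - 1) / 2" and "s = sqrt (\<theta>\<^sup>2 + \<sigma>\<^sup>2)"
    and "\<alpha> = sqrt (\<theta>\<^sup>2 + \<sigma>\<^sup>2) / \<sigma>\<^sup>2" and "\<beta> = \<theta> / \<sigma>\<^sup>2"
  define w where "w = (\<lambda>t. exp (\<theta> * t / \<sigma>\<^sup>2) * \<bar>t\<bar> powr \<nu> * bessel_K \<nu> (\<alpha> * \<bar>t\<bar>))"
  \<comment> \<open>The normalising factor: the density is \<open>D * w\<close>, and
    \<open>T\<close> is its reciprocal.\<close>
  define D where "D = 1 / (\<sigma> * sqrt pi * Gamma (r / 2)) / (2 * s) powr \<nu>"
  define T where "T = \<sigma> * sqrt pi * Gamma (r / 2) * (2 * s) powr \<nu>"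
  define C where "C = vg_const_base r \<theta> \<sigma>"
  have \<nu>: "\<nu> > -1/2" and \<nu>r: "2 * \<nu> + 1 = r" using r by (simp_all add: \<nu>_def field_simps)
  have s: "s > 0" using \<sigma> by (simp add: s_def add_nonneg_pos)
  have \<alpha>: "\<alpha> > 0" using s \<sigma> by (simp add: \<alpha>_def s_def)
  have s\<alpha>: "\<sigma>\<^sup>2 * \<alpha> = s" using \<sigma> by (simp add: \<alpha>_def s_def)
  have "\<bar>\<theta>\<bar> < s" unfolding s_def using \<sigma> by (intro real_less_rsqrt) simp
  then have \<beta>: "\<bar>\<beta>\<bar> < \<alpha>" using \<sigma> by (simp add: \<alpha>_def \<beta>_def s_def divide_strict_right_mono)
  have G2: "Gamma (r / 2) > 0" using r by (intro Gamma_real_pos) simp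
  have D: "D > 0" using G2 \<sigma> s by (simp add: D_def)
  have DT: "D * T = 1" using G2 \<sigma> s by (simp add: D_def T_def)
  have w_nonneg: "0 \<le> w t" for t
    using \<alpha> bessel_K_nonneg[of "\<alpha> * \<bar>t\<bar>" \<nu>] by (cases "t = 0") (simp_all add: w_def)
  have "vg_density r \<theta> \<sigma> x = D * w x" for x
    unfolding vg_density_def \<alpha>_def[symmetric] unfolding \<nu>_def[symmetric] s_def[symmetric] D_def w_def
    using s by (simp add: powr_divide)
  then have dist: "distributed M lborel Z (\<lambda>x. ennreal (D * w x))"
    using assms(4) by simp
  have p: "0 \<le> D * w x" for x using D w_nonneg by simp
  have Z: "Z \<in> borel_measurable M"
    using distributed_measurable[OF dist] by simp
  have h_Z: "(\<lambda>\<omega>. h (Z \<omega>)) \<in> borel_measurable M"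
    using measurable_compose[OF Z assms(5)] .
  obtain B where B: "\<And>x. \<bar>h x\<bar> \<le> B"
    using assms(6) by (auto simp: bounded_iff)
  have int_hZ: "integrable M (\<lambda>\<omega>. h (Z \<omega>))"
    by (rule integrable_const_bound[of _ B]) (use B h_Z in auto)
  have ht: "ht \<in> borel_measurable borel"
    unfolding ht_def using assms(5) by simp
  define G where "G = sup_norm ht"
  have G: "\<bar>ht x\<bar> \<le> G" for x
  proof -
    have "\<bar>ht x\<bar> \<le> B + \<bar>LINT \<omega>|M. h (Z \<omega>)\<bar>" for x
      unfolding ht_def using B[of x] by linarith
    then have "bdd_above (range (\<lambda>x. \<bar>ht x\<bar>))" by (intro bdd_aboveI) auto
    then show ?thesis unfolding G_def sup_norm_on_def by (intro cSUP_upper) auto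
  qed
  \<comment> \<open>Integrating the constant 1 against the law of Z gives both the integrability of
    w and its mass 1/D; no Bessel integral is evaluated.\<close>
  have w_int: "integrable lborel w" and w_total: "(\<integral>t. w t \<partial>lborel) = T"
  proof -
    have "integrable lborel (\<lambda>x. D * w x * 1)"
      using distributed_integrable[OF dist, of "\<lambda>_. 1"] p by simp
    then show "integrable lborel w" using D by simp
    have "(\<integral>x. D * w x * 1 \<partial>lborel) = (\<integral>x. 1 \<partial>M)"
      by (rule distributed_integral[OF dist _ p]) simp
    then have "D * (\<integral>t. w t \<partial>lborel) = D * T" using DT prob_space by simp
    then show "(\<integral>t. w t \<partial>lborel) = T" using D by simp
  qed
  have wh_int: "integrable lborel (\<lambda>t. w t * ht t)" and wh_zero: "(\<integral>t. w t * ht t \<partial>lborel) = 0"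
  proof -
    have "integrable M (\<lambda>\<omega>. ht (Z \<omega>))"
      unfolding ht_def by (intro Bochner_Integration.integrable_diff int_hZ) simp
    then have "integrable lborel (\<lambda>x. D * w x * ht x)"
      using distributed_integrable[OF dist, of ht] ht p by simp
    then show "integrable lborel (\<lambda>t. w t * ht t)" using D by (simp add: mult.assoc)
    have "(\<integral>x. D * w x * ht x \<partial>lborel) = (\<integral>\<omega>. ht (Z \<omega>) \<partial>M)"
      by (rule distributed_integral[OF dist _ p]) (use ht in simp)
    also have "\<dots> = 0"
      unfolding ht_def using int_hZ by (simp add: prob_space)
    finally show "(\<integral>t. w t * ht t \<partial>lborel) = 0" using D by (simp add: mult.assoc)
  qed
  have w_pos: "w t = exp (\<beta> * t) * t powr \<nu> * bessel_K \<nu> (\<alpha> * t)"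
    and w_neg: "w (- t) = exp (- \<beta> * t) * t powr \<nu> * bessel_K \<nu> (\<alpha> * t)" if "t \<in> {0<..}" for t
    using that by (simp_all add: w_def \<beta>_def)
  note halves = integral_eq_half_lines[OF w_int]
  have iK: "set_integrable lborel {0<..} (\<lambda>t. exp (\<beta> * t) * t powr \<nu> * bessel_K \<nu> (\<alpha> * t))"
    by (rule iffD1[OF set_integrable_cong[OF refl refl] halves(1)]) (rule w_pos)
  have iK': "set_integrable lborel {0<..} (\<lambda>t. exp (- \<beta> * t) * t powr \<nu> * bessel_K \<nu> (\<alpha> * t))"
    by (rule iffD1[OF set_integrable_cong[OF refl refl] halves(2)]) (rule w_neg)
  have T_split: "T = (LBINT t:{0<..}. exp (\<beta> * t) * t powr \<nu> * bessel_K \<nu> (\<alpha> * t))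
      + (LBINT t:{0<..}. exp (- \<beta> * t) * t powr \<nu> * bessel_K \<nu> (\<alpha> * t))"
  proof -
    have "(LBINT t:{0<..}. w t) = (LBINT t:{0<..}. exp (\<beta> * t) * t powr \<nu> * bessel_K \<nu> (\<alpha> * t))"
      by (rule set_lebesgue_integral_cong) (use w_pos in auto)
    moreover have "(LBINT t:{0<..}. w (- t)) = (LBINT t:{0<..}. exp (- \<beta> * t) * t powr \<nu> * bessel_K \<nu> (\<alpha> * t))"
      by (rule set_lebesgue_integral_cong) (use w_neg in auto)
    ultimately show ?thesis using halves(3) w_total by (simp only:)
  qed

  interpret R: vg_half_line \<nu> \<alpha> \<beta> G ht
    by unfold_locales (use \<nu> \<alpha> \<beta> ht G iK in auto)
  interpret L: vg_half_line \<nu> \<alpha> "- \<beta>" G "\<lambda>t. ht (- t)"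
    by unfold_locales (use \<nu> \<alpha> \<beta> ht G iK' in auto)
  \<comment> \<open>\<open>c\<close> depends on \<open>\<nu>\<close> and \<open>\<alpha>\<close>
    only, so the same identity serves the reflected half-line.\<close>
  have C: "\<alpha> * (R.c * T) = C"
    using vg_total_mass_constant[OF r \<sigma>, of \<theta>]
    unfolding R.c_def unfolding T_def C_def \<nu>_def \<alpha>_def s_def .
  have RJ: "(if \<beta> \<ge> 0 then 1 else 2) * R.J \<le> T"
    by (rule R.J_weighted_le[OF iK']) (simp add: T_split R.J_def R.wK_def)
  have LJ: "(if - \<beta> \<ge> 0 then 1 else 2) * L.J \<le> T"
    by (rule L.J_weighted_le) (use iK in \<open>simp_all add: T_split L.J_def L.wK_def\<close>)
  note R_bounds = R.F_F'_uniform_bound[OF RJ C, unfolded \<nu>r]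
  note L_bounds = L.F_F'_uniform_bound[OF LJ C, unfolded \<nu>r]

  have f_pos: "f x = - (1 / \<sigma>\<^sup>2) * R.F x" if x: "x > 0" for x
    using x vg_stein_formula_pos[OF \<sigma> R.vg_half_line_axioms[unfolded \<nu>_def \<alpha>_def \<beta>_def] x]
    by (simp add: f_def vg_stein_solution_def \<nu>_def \<alpha>_def \<beta>_def)
  have f_neg: "f (- x) = 1 / \<sigma>\<^sup>2 * L.F x" if x: "x > 0" for x
  proof -
    have "vg_stein_formula r \<theta> \<sigma> ht (- x) = - vg_stein_formula r (- \<theta>) \<sigma> (\<lambda>t. ht (- t)) x"
      by (rule vg_stein_formula_reflect) (use wh_int wh_zero in \<open>simp_all add: w_def \<nu>_def \<alpha>_def\<close>)
    moreover have "vg_half_line ((r - 1) / 2) (sqrt ((- \<theta>)\<^sup>2 + \<sigma>\<^sup>2) / \<sigma>\<^sup>2) (- \<theta> / \<sigma>\<^sup>2) G (\<lambda>t. ht (- t))"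
      using L.vg_half_line_axioms by (simp add: \<nu>_def \<alpha>_def \<beta>_def)
    note vg_stein_formula_pos[OF \<sigma> this x]
    ultimately show ?thesis
      using x by (simp add: f_def vg_stein_solution_def \<nu>_def \<alpha>_def \<beta>_def)
  qed

  define Bf where "Bf = G / s * (2 / r + vg_const r \<theta> \<sigma>)"
  define Bd where "Bd = G / \<sigma>\<^sup>2 * (2 / r + vg_const r \<theta> \<sigma>)"
  have CC: "C \<le> vg_const r \<theta> \<sigma>" unfolding C_def by (rule vg_const_base_le[OF r \<sigma>])
  \<comment> \<open>The half-line bound on f has 1/r; it is rounded up to the 2/r of the
    statement.\<close>
  have to_Bf: "1 / \<sigma>\<^sup>2 * y \<le> Bf" if "y \<le> G / \<alpha> * (1 / r + C)" for y
  proof -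
    have "1 / \<sigma>\<^sup>2 * y \<le> 1 / \<sigma>\<^sup>2 * (G / \<alpha> * (1 / r + C))" by (rule mult_left_mono[OF that]) simp
    also have "\<dots> = G / s * (1 / r + C)" using \<sigma> by (simp flip: s\<alpha>)
    also have "\<dots> \<le> Bf"
      unfolding Bf_def using R.G_nonneg s r CC by (intro mult_left_mono add_mono divide_right_mono) auto
    finally show ?thesis .
  qed
  have to_Bd: "1 / \<sigma>\<^sup>2 * y \<le> Bd" if "y \<le> G * (2 / r + C)" for y
  proof -
    have "1 / \<sigma>\<^sup>2 * y \<le> 1 / \<sigma>\<^sup>2 * (G * (2 / r + C))" by (rule mult_left_mono[OF that]) simp
    also have "\<dots> = G / \<sigma>\<^sup>2 * (2 / r + C)" by simp
    also have "\<dots> \<le> Bd"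
      unfolding Bd_def using R.G_nonneg CC by (intro mult_left_mono add_left_mono) auto
    finally show ?thesis .
  qed

  define l where "l = - (1 / \<sigma>\<^sup>2) * (R.c * (LBINT t:{0<..}. R.wK t * ht t))"
  have right: "(f \<longlongrightarrow> l) (at_right 0)"
  proof -
    have "((\<lambda>x. - (1 / \<sigma>\<^sup>2) * R.F x) \<longlongrightarrow> l) (at_right 0)"
      unfolding l_def by (intro tendsto_intros R.F_tendsto_0)
    then show ?thesis
      by (elim Lim_transform_eventually) (auto simp: eventually_at_filter f_pos)
  qed
  \<comment> \<open>The one-sided limits are multiples, with opposite signs, of the integrals of the
    K-weight times \<open>ht\<close> over the two halves. They agree because these integrals add up
    to 0.\<close>
  have left: "(f \<longlongrightarrow> l) (at_left 0)"
  proof -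
    note wh = integral_eq_half_lines[OF wh_int]
    have "(LBINT t:{0<..}. w t * ht t) = (LBINT t:{0<..}. R.wK t * ht t)"
      by (rule set_lebesgue_integral_cong) (auto simp: R.wK_def w_pos)
    moreover have "(LBINT t:{0<..}. w (- t) * ht (- t)) = (LBINT t:{0<..}. L.wK t * ht (- t))"
      by (rule set_lebesgue_integral_cong) (auto simp: L.wK_def w_neg)
    ultimately have "(LBINT t:{0<..}. L.wK t * ht (- t)) = - (LBINT t:{0<..}. R.wK t * ht t)"
      using wh(3) wh_zero by simp
    then have l_eq: "l = 1 / \<sigma>\<^sup>2 * (R.c * (LBINT t:{0<..}. L.wK t * ht (- t)))"
      by (simp add: l_def)
    have "((\<lambda>x. 1 / \<sigma>\<^sup>2 * L.F x) \<longlongrightarrow> l) (at_right 0)"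
      unfolding l_eq by (intro tendsto_intros L.F_tendsto_0)
    then have "((\<lambda>x. f (- x)) \<longlongrightarrow> l) (at_right 0)"
      by (elim Lim_transform_eventually) (auto simp: eventually_at_filter f_neg)
    then show ?thesis by (simp add: filterlim_at_left_to_right)
  qed
  have f_lim: "(f \<longlongrightarrow> l) (at 0)" using left right by (simp add: filterlim_at_split)
  then have "(vg_stein_formula r \<theta> \<sigma> ht \<longlongrightarrow> l) (at 0)"
    by (elim Lim_transform_eventually) (auto simp: eventually_at_filter f_def vg_stein_solution_def)
  then have f0: "f 0 = l"
    by (simp add: f_def vg_stein_solution_def tendsto_Lim)
  have cont: "isCont f 0" using f_lim by (simp add: isCont_def f0)

  have f_bound_pos: "\<bar>f x\<bar> \<le> Bf" if "x > 0" for x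
    using to_Bf[OF R_bounds(1)[OF that]] by (simp add: f_pos[OF that] abs_mult)
  have f_bound: "\<bar>f x\<bar> \<le> Bf" for x
  proof (cases x "0 :: real" rule: linorder_cases)
    case less
    then show ?thesis using to_Bf[OF L_bounds(1)[of "- x"]] f_neg[of "- x"] by (simp add: abs_mult)
  next
    case equal
    have "((\<lambda>x. \<bar>f x\<bar>) \<longlongrightarrow> \<bar>l\<bar>) (at_right 0)" by (intro tendsto_rabs right)
    then have "\<bar>l\<bar> \<le> Bf"
      by (rule tendsto_upperbound) (auto simp: eventually_at_filter f_bound_pos)
    then show ?thesis by (simp add: equal f0)
  qed (rule f_bound_pos)

  have d_pos: "(f has_real_derivative - (1 / \<sigma>\<^sup>2) * R.F' x) (at x)" if x: "x > 0" for x
  proof (rule has_field_derivative_transform_within_open[where S = "{0<..}"])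
    show "((\<lambda>x. - (1 / \<sigma>\<^sup>2) * R.F x) has_real_derivative - (1 / \<sigma>\<^sup>2) * R.F' x) (at x)"
      by (intro DERIV_cmult R.F_deriv x)
  qed (use x f_pos in auto)
  have d_neg: "(f has_real_derivative - (1 / \<sigma>\<^sup>2) * L.F' (- x)) (at x)" if x: "x < 0" for x
  proof (rule has_field_derivative_transform_within_open[where S = "{..<0}"])
    have "((\<lambda>x. L.F (- x)) has_real_derivative L.F' (- x) * - 1) (at x)"
      using x by (intro DERIV_chain2[OF L.F_deriv]) (auto intro!: derivative_eq_intros)
    from DERIV_cmult[OF this, of "1 / \<sigma>\<^sup>2"]
    show "((\<lambda>x. 1 / \<sigma>\<^sup>2 * L.F (- x)) has_real_derivative - (1 / \<sigma>\<^sup>2) * L.F' (- x)) (at x)"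
      by simp
    show "1 / \<sigma>\<^sup>2 * L.F (- y) = f y" if "y \<in> {..<0}" for y
      using f_neg[of "- y"] that by simp
  qed (use x in auto)
  have b_pos: "\<bar>- (1 / \<sigma>\<^sup>2) * R.F' x\<bar> \<le> Bd" if "x > 0" for x
    using to_Bd[OF R_bounds(2)[OF that]] by (simp add: abs_mult)
  have b_neg: "\<bar>- (1 / \<sigma>\<^sup>2) * L.F' (- x)\<bar> \<le> Bd" if "x < 0" for x
    using to_Bd[OF L_bounds(2)[of "- x"]] that by (simp add: abs_mult)
  have differentiable: "f differentiable (at x)" if "x \<noteq> 0" for x
    using that d_pos d_neg by (cases "x > 0") (auto simp: real_differentiable_def not_less less_eq_real_def)
  have deriv_bound: "\<bar>deriv f x\<bar> \<le> Bd" if "f differentiable (at x)" for x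
  proof (cases x "0 :: real" rule: linorder_cases)
    case less
    then show ?thesis using DERIV_imp_deriv[OF d_neg[OF less]] b_neg[OF less] by simp
  next
    case equal
    then have "(f has_real_derivative deriv f 0) (at 0)"
      using that by (simp add: DERIV_deriv_iff_real_differentiable)
    then show ?thesis using bounded_deriv_at_limit[OF d_pos b_pos] equal by simp
  next
    case greater
    then show ?thesis using DERIV_imp_deriv[OF d_pos[OF greater]] b_pos[OF greater] by simp
  qed

  have "bounded (range f)" using f_bound by (auto simp: bounded_iff)
  moreover have "sup_norm f \<le> Bf"
    unfolding sup_norm_on_def by (rule cSUP_least) (use f_bound in auto)
  moreover have "bounded (deriv f ` {x. f differentiable (at x)})"
    using deriv_bound by (auto simp: bounded_iff)
  \<comment> \<open>Differentiability at 1 shows that the supremum is over a nonempty set.\<close>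
  moreover have "sup_norm_on {x. f differentiable (at x)} (deriv f) \<le> Bd"
    unfolding sup_norm_on_def
    by (rule cSUP_least) (use deriv_bound differentiable[of 1] in auto)
  ultimately show ?thesis
    using cont differentiable unfolding Bf_def Bd_def G_def s_def by blast
qed

end
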